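(* For any trinity with color classes $V,E,R$, the equivalence classes in $\mathcal{A}_W$ containing at least one element of the form $(x_V,\mathbf{0},\mathbf{0})$ with $x_V\in\mathbb{Z}^V$ form a group (a subgroup of $\mathcal{A}_W$) isomorphic to $\mathrm{Pic}(D_V)\cong \mathrm{Pic}^0(D_V)\times\mathbb{Z}$.
   Context: Trinities. A trinity is a triangulation of the oriented sphere $S^2$ (multiple edges between the same two points are allowed) together with a coloring of its points ($0$-simplices) with three colors, red, emerald and violet, such that points joined by an edge have different colors. The sets of red, emerald and violet points are $R$, $E$, $V$. Each edge is colored with the color not occurring among its ends. A triangle is white if its red, emerald and violet nodes follow each other in clockwise order, and black otherwise; triangles sharing an edge have different colors. $D_V$ is the digraph on $V$ having, for each violet edge, one directed edge from the violet node of the black triangle containing that violet edge to the violet node of the white triangle containing it. $D_V$ is connected and Eulerian. Sandpile groups. For an Eulerian digraph $D$ with vertex set $W$, $\mathrm{Div}(D)=\mathbb{Z}^W$, and $\deg(x)=\sum_{w\in W}x(w)$. Let $d(u,v)$ be the number of edges from $u$ to $v$ and $d^+(v)$ the outdegree. $L_D\in\mathbb{Z}^{W\times W}$ has entries $L_D(u,v)=d(v,u)$ for $u\ne v$ and $L_D(v,v)=d(v,v)-d^+(v)$. Write $x\sim y$ if $y=x+L_Dz$ for some $z\in\mathbb{Z}^W$. $\mathrm{Pic}(D)=\mathrm{Div}(D)/\sim$, and the sandpile group $\mathrm{Pic}^0(D)$ is its subgroup of classes of degree $0$. Trinity sandpile group. $\mathcal{A}$ is the free Abelian group on $V\cup E\cup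 R$, with elements written as triples $(x_V,x_E,x_R)$, $x_V\in\mathbb{Z}^V$, $x_E\in\mathbb{Z}^E$, $x_R\in\mathbb{Z}^R$. Two elements of $\mathcal{A}$ are white triangle equivalent ($\approx_W$) if their difference is an integer linear combination of characteristic vectors of white triangles (the characteristic vector of a triangle is $1$ on its three nodes and $0$ elsewhere). $\mathcal{A}_W=\mathcal{A}/{\approx_W}$. *)

theory Defs
  imports "HOL-Homology.Homology" "Graph_Theory.Digraph"
begin

section \<open>Triangulations of the sphere\<close>

type_synonym point = "real ^ 3"

abbreviation S2 :: "point set"
  where "S2 \<equiv> sphere 0 1"

definition std_triangle :: "complex set"
  where "std_triangle = convex hull {0, 1, \<i>}"

text \<open>
  An edge is the arc it occupies on the sphere and a triangle is the closed disc it occupies, so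
  that several edges may join the same two points, and several triangles may have the same nodes.
  The ends of an edge and the nodes of a triangle are the points of the triangulation on it; they
  are distinct, which is no restriction here, since in a trinity they have different colors.

  The function \<open>next_node\<close> is the orientation: \<open>next_node t p\<close> is the
  node of the triangle \<open>t\<close> that follows its node \<open>p\<close> in clockwise order.
\<close>

datatype color = Red | Emerald | Violet

record trinity_data =
  points :: "point set"
  edges :: "point set set"
  triangles :: "point set set"
  color_of :: "point \<Rightarrow> color"
  next_node :: "point set \<Rightarrow> point \<Rightarrow> point"

definition sides :: "trinity_data \<Rightarrow> point set \<Rightarrow> point set set"
  where "sides T t = {e \<in> edges T. e \<subseteq> t}"

locale sphere_triangulation =
  fixes T :: trinity_data
  assumes finite_points: "finite (points T)"
    and finite_edges: "finite (edges T)"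
    and finite_triangles: "finite (triangles T)"
    and edge_arc: "e \<in> edges T \<Longrightarrow>
      \<exists>g. arc g \<and> path_image g = e \<and> points T \<inter> e = {pathstart g, pathfinish g}"
    and triangle_disc: "t \<in> triangles T \<Longrightarrow>
      \<exists>f f'. homeomorphism std_triangle t f f'
        \<and> points T \<inter> t = {f 0, f 1, f \<i>}
        \<and> sides T t = {f ` closed_segment 0 1, f ` closed_segment 1 \<i>, f ` closed_segment \<i> 0}"
    and edge_is_side: "e \<in> edges T \<Longrightarrow> \<exists>t\<in>triangles T. e \<in> sides T t"
    and edges_meet: "\<lbrakk>e \<in> edges T; e' \<in> edges T; e \<noteq> e'\<rbrakk> \<Longrightarrow> e \<inter> e' \<subseteq> points T"
    and triangles_meet: "\<lbrakk>t \<in> triangles T; t' \<in> triangles T; t \<noteq> t'\<rbrakk> \<Longrightarrow>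
      t \<inter> t' \<subseteq> points T \<union> \<Union>(sides T t \<inter> sides T t')"
    and points_on_sphere: "points T \<subseteq> S2"
    and triangles_cover: "\<Union>(triangles T) = S2"

text \<open>
  The orientation of the sphere is given simplicially, by cyclic orders of the nodes of the
  triangles such that any two triangles with a common side induce opposite directions on it. The
  sphere being connected, there are exactly two such choices, one for each orientation.
\<close>

locale oriented_sphere_triangulation = sphere_triangulation +
  assumes cyclic_order: "t \<in> triangles T \<Longrightarrow>
      \<exists>a b c. distinct [a, b, c] \<and> points T \<inter> t = {a, b, c}
        \<and> next_node T t a = b \<and> next_node T t b = c \<and> next_node T t c = a"
    and coherent: "\<lbrakk>t \<in> triangles T; t' \<in> triangles T; t \<noteq> t'; e \<in> sides T t \<inter> sides T t';
      points T \<inter> e = {p, q}; next_node T t p = q\<rbrakk> \<Longrightarrow> next_node T t' q = p"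


section \<open>Trinities\<close>

locale trinity = oriented_sphere_triangulation +
  assumes proper_coloring: "\<lbrakk>e \<in> edges T; p \<in> points T \<inter> e; q \<in> points T \<inter> e; p \<noteq> q\<rbrakk> \<Longrightarrow>
      color_of T p \<noteq> color_of T q"

definition color_class :: "trinity_data \<Rightarrow> color \<Rightarrow> point set"
  where "color_class T c = {p \<in> points T. color_of T p = c}"

definition edges_of_color :: "trinity_data \<Rightarrow> color \<Rightarrow> point set set"
  where "edges_of_color T c = {e \<in> edges T. \<forall>p \<in> points T \<inter> e. color_of T p \<noteq> c}"

definition white :: "trinity_data \<Rightarrow> point set set"
  where "white T = {t \<in> triangles T.
    \<exists>r \<in> t \<inter> color_class T Red. \<exists>e \<in> t \<inter> color_class T Emerald. \<exists>v \<in> t \<inter> color_class T Violet.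
      next_node T t r = e \<and> next_node T t e = v \<and> next_node T t v = r}"

definition black :: "trinity_data \<Rightarrow> point set set"
  where "black T = triangles T - white T"

definition violet_digraph :: "trinity_data \<Rightarrow> (point, point set) pre_digraph"
  where "violet_digraph T =
    \<lparr>verts = color_class T Violet,
     arcs = edges_of_color T Violet,
     tail = (\<lambda>e. THE v. v \<in> color_class T Violet \<and> (\<exists>t \<in> black T. e \<in> sides T t \<and> v \<in> t)),
     head = (\<lambda>e. THE v. v \<in> color_class T Violet \<and> (\<exists>t \<in> white T. e \<in> sides T t \<and> v \<in> t))\<rparr>"


section \<open>Sandpile groups\<close>

definition Div :: "('a, 'b) pre_digraph \<Rightarrow> ('a \<Rightarrow>\<^sub>0 int) monoid"
  where "Div D = free_Abelian_group (verts D)"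

definition deg :: "('a, 'b) pre_digraph \<Rightarrow> ('a \<Rightarrow>\<^sub>0 int) \<Rightarrow> int"
  where "deg D x = (\<Sum>w\<in>verts D. Poly_Mapping.lookup x w)"

definition arc_count :: "('a, 'b) pre_digraph \<Rightarrow> 'a \<Rightarrow> 'a \<Rightarrow> nat"
  where "arc_count D u v = card {a \<in> arcs D. tail D a = u \<and> head D a = v}"

definition laplacian :: "('a, 'b) pre_digraph \<Rightarrow> 'a \<Rightarrow> 'a \<Rightarrow> int"
  where "laplacian D u v =
    (if u = v then int (arc_count D v v) - int (out_degree D v) else int (arc_count D v u))"

definition laplacian_apply :: "('a, 'b) pre_digraph \<Rightarrow> ('a \<Rightarrow>\<^sub>0 int) \<Rightarrow> ('a \<Rightarrow>\<^sub>0 int)"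
  where "laplacian_apply D z =
    (\<Sum>u\<in>verts D. frag_cmul (\<Sum>v\<in>verts D. laplacian D u v * Poly_Mapping.lookup z v) (frag_of u))"

definition Pic :: "('a, 'b) pre_digraph \<Rightarrow> ('a \<Rightarrow>\<^sub>0 int) set monoid"
  where "Pic D = Div D Mod (laplacian_apply D ` carrier (Div D))"

definition Pic0 :: "('a, 'b) pre_digraph \<Rightarrow> ('a \<Rightarrow>\<^sub>0 int) set monoid"
  where "Pic0 D = (Pic D)\<lparr>carrier := {X \<in> carrier (Pic D). \<forall>x\<in>X. deg D x = 0}\<rparr>"


section \<open>The trinity sandpile group\<close>

text \<open>The points of a trinity are the disjoint union of its color classes. The triples
  \<open>(x\<^sub>V, 0, 0)\<close> are the elements of the free Abelian group on the points that are
  supported on the violet ones.\<close>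

definition trinity_chains :: "trinity_data \<Rightarrow> (point \<Rightarrow>\<^sub>0 int) monoid"
  where "trinity_chains T =
    free_Abelian_group (color_class T Violet \<union> color_class T Emerald \<union> color_class T Red)"

definition char_vec :: "trinity_data \<Rightarrow> point set \<Rightarrow> (point \<Rightarrow>\<^sub>0 int)"
  where "char_vec T t = (\<Sum>p \<in> points T \<inter> t. frag_of p)"

definition white_span :: "trinity_data \<Rightarrow> (point \<Rightarrow>\<^sub>0 int) set"
  where "white_span T = range (\<lambda>c. \<Sum>t\<in>white T. frag_cmul (c t) (char_vec T t))"

definition trinity_group :: "trinity_data \<Rightarrow> (point \<Rightarrow>\<^sub>0 int) set monoid"
  where "trinity_group T = trinity_chains T Mod white_span T"

definition violet_classes :: "trinity_data \<Rightarrow> (point \<Rightarrow>\<^sub>0 int) set set"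
  where "violet_classes T = {X \<in> carrier (trinity_group T).
    \<exists>x\<in>X. x \<in> carrier (free_Abelian_group (color_class T Violet))}"

end

theory Submission
  imports Defs "HOL-Analysis.Further_Topology"
begin

text \<open>
  Sending a divisor \<open>x\<close> of the violet digraph to the class of \<open>(x, 0, 0)\<close> is a homomorphism whose
  image is the set of violet classes. Hence these form a subgroup, and the isomorphism with the
  Picard group amounts to one equality of subgroups of the divisors: the integer combinations of
  white triangles that are supported on the violet points are exactly the image of the Laplacian
  (\<open>violet_part_of_white_span\<close>).

  Every violet edge lies in exactly one white triangle, so the coefficients \<open>c\<close> of such a combination
  are weights on the arcs of the digraph. The red and emerald components vanish if and only if \<open>c\<close>
  sums to zero over the white triangles around each point that is not violet; call \<open>c\<close> balanced
  then. On the other hand, the combination with coefficients \<open>z (tail w) - z (head w)\<close>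
  is the Laplacian of \<open>z\<close>. So it has to be shown that the balanced weights are the coboundaries of
  functions on the violet points. That coboundaries are balanced is local: the sides of two colors at
  a point \<open>p\<close> pair the white triangles at \<open>p\<close> with the black ones in two ways, and if \<open>p\<close> is not violet
  then one of these pairings preserves the violet node (\<open>coboundary_balanced\<close>).

  The converse (\<open>balanced_imp_coboundary\<close>) is the vanishing of the first cohomology of the sphere,
  read in the dual cell structure. What is sought is an integer function on the triangles that
  changes by \<open>c\<close> across violet edges and does not change across the other edges. The triangles around
  a point form a single cycle, along which these changes add up to zero because \<open>c\<close> is balanced, so
  there are solutions near each point (\<open>potential_at_point\<close>). Blended with a partition of unity they
  give real functions on the triangles that differ by integers on intersections, that is, one
  continuous map from the sphere to the circle. As the sphere is simply connected, this map
  has a real logarithm, and on each triangle the logarithm differs from the blended function by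
  an integer constant; these constants are the corrections that turn the local solutions into a
  global one (\<open>local_potentials_glue\<close>). The global solution is constant around each violet
  point, so it is a function on the violet points.

  Two local facts carry the combinatorics. Each edge is a side of exactly two triangles, one white
  and one black: a second triangle exists by invariance of domain, and the coherence of the
  orientation excludes a third one and makes the colors differ. The triangles at a point are
  connected through the edges at that point (\<open>star_connected\<close>), because small punctured discs are
  connected.

  Finally the degree maps the Picard group onto the integers with kernel the classes of degree zero,
  and the class of a vertex splits this map.
\<close>


section \<open>Small discs in the sphere\<close>

text \<open>Stereographic projection from the antipode of \<open>p\<close>. Only the inverse chart is kept, because it is
  defined on the whole plane, where invariance of domain and the connectedness of punctured balls
  are available.\<close>

lemma S2_chart:
  assumes p: "p \<in> S2"
  obtains k :: "complex \<Rightarrow> point" and z where "continuous_on UNIV k" "inj k" "k z = p"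
    "\<And>W. open W \<Longrightarrow> openin (top_of_set S2) (k ` W)"
    "\<And>N. openin (top_of_set S2) N \<Longrightarrow> open (k -` N)"
proof -
  have q: "- p \<in> S2" "- p \<noteq> p"
    using p by (auto simp: neg_eq_iff_add_eq_0 simp flip: scaleR_2)
  have "(S2 - {- p}) homeomorphic (UNIV :: complex set)"
    by (rule homeomorphic_punctured_sphere_affine) (use q in auto)
  then obtain k k' where k: "homeomorphism (UNIV :: complex set) (S2 - {- p}) k k'"
    unfolding homeomorphic_def using homeomorphism_symD by blast
  note cont = homeomorphism_cont1[OF k]
  show thesis
  proof (rule that[OF cont])
    show "inj k" using homeomorphism_apply1[OF k] by (auto intro: inj_on_inverseI)
    show "k (k' p) = p" using homeomorphism_apply2[OF k, of p] p q by auto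
    show "openin (top_of_set S2) (k ` W)" if "open W" for W
    proof -
      have "openin (top_of_set (S2 - {- p})) (k ` W)"
        using homeomorphism_imp_open_map[OF k, of W] that by simp
      moreover have "openin (top_of_set S2) (S2 - {- p})" by (simp add: openin_delete)
      ultimately show ?thesis using openin_trans by blast
    qed
    show "open (k -` N)" if N: "openin (top_of_set S2) N" for N
    proof -
      obtain S where S: "open S" "N = S2 \<inter> S" using openin_open[THEN iffD1, OF N] by blast
      have "range k \<subseteq> S2" using homeomorphism_image1[OF k] by blast
      then have "k -` N = k -` S" unfolding S(2) by blast
      then show ?thesis using cont S(1) by (simp add: open_vimage continuous_on_eq_continuous_at)
    qed
  qed
qed

lemma punctured_neighbourhood_in_S2:
  assumes N: "openin (top_of_set S2) N" and p: "p \<in> N"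
  obtains U where "openin (top_of_set S2) U" "p \<in> U" "U \<subseteq> N" "connected (U - {p})"
proof -
  have "p \<in> S2" using N p openin_imp_subset by blast
  then obtain k :: "complex \<Rightarrow> point" and z where k: "continuous_on UNIV k" "inj k" "k z = p"
    "\<And>W. open W \<Longrightarrow> openin (top_of_set S2) (k ` W)"
    "\<And>N. openin (top_of_set S2) N \<Longrightarrow> open (k -` N)"
    using S2_chart by metis
  have "z \<in> k -` N" using p k(3) by simp
  then obtain e where e: "e > 0" "ball z e \<subseteq> k -` N"
    by (rule openE[OF k(5)[OF N]])
  show thesis
  proof (rule that)
    show "openin (top_of_set S2) (k ` ball z e)" by (rule k(4)) simp
    show "p \<in> k ` ball z e" using e k(3) by auto
    show "k ` ball z e \<subseteq> N" using e by auto
    have "k ` ball z e - {p} = k ` (ball z e - {z})"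
      using k(2,3) by (simp add: image_set_diff)
    moreover have "connected (ball z e - {z})"
      by (intro connected_open_delete) auto
    ultimately show "connected (k ` ball z e - {p})"
      using k(1) by (metis connected_continuous_image continuous_on_subset subset_UNIV)
  qed
qed

text \<open>Invariance of domain in a chart. It is applied to a chart of a closed triangle, to show that a point
  on a side of the triangle is not interior to it relative to the sphere.\<close>

lemma planar_image_of_open_in_S2:
  fixes f :: "point \<Rightarrow> complex"
  assumes U: "openin (top_of_set S2) U" and f: "continuous_on U f" "inj_on f U"
  shows "f ` U \<subseteq> interior (f ` U)"
proof
  fix y assume "y \<in> f ` U"
  then obtain p where p: "p \<in> U" "y = f p" by auto
  have "p \<in> S2" using U p openin_imp_subset by blast
  then obtain k :: "complex \<Rightarrow> point" and z where k: "continuous_on UNIV k" "inj k" "k z = p"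
    "\<And>N. openin (top_of_set S2) N \<Longrightarrow> open (k -` N)"
    using S2_chart by metis
  have kU: "k ` (k -` U) \<subseteq> U" by auto
  have "open ((f \<circ> k) ` (k -` U))"
  proof (rule invariance_of_domain)
    show "continuous_on (k -` U) (f \<circ> k)"
      by (rule continuous_on_compose) (use k(1) f(1) kU in \<open>auto intro: continuous_on_subset\<close>)
    show "inj_on (f \<circ> k) (k -` U)"
      by (rule comp_inj_on) (use k(2) f(2) kU in \<open>auto intro: inj_on_subset\<close>)
    show "open (k -` U)" by (rule k(4)[OF U])
  qed
  moreover have "y \<in> (f \<circ> k) ` (k -` U)" using k(3) p by auto
  moreover have "(f \<circ> k) ` (k -` U) \<subseteq> f ` U" by auto
  ultimately show "y \<in> interior (f ` U)" by (meson interiorI)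
qed

lemma convex_combination_sum_le_one:
  fixes a b :: real
  assumes "a \<ge> 0" "b \<ge> 0" "a + b = 1" "x + y \<le> 1" "x' + y' \<le> 1"
  shows "a * x + b * x' + (a * y + b * y') \<le> 1"
  using convex_bound_le[of "x + y" 1 "x' + y'" a b] assms by (simp add: algebra_simps)

lemma std_triangle_coords: "z \<in> std_triangle \<Longrightarrow> 0 \<le> Re z \<and> 0 \<le> Im z \<and> Re z + Im z \<le> 1"
proof -
  have "convex {z. 0 \<le> Re z \<and> 0 \<le> Im z \<and> Re z + Im z \<le> 1}"
    by (intro convexI) (simp add: convex_combination_sum_le_one)
  then have "std_triangle \<subseteq> {z. 0 \<le> Re z \<and> 0 \<le> Im z \<and> Re z + Im z \<le> 1}"
    unfolding std_triangle_def by (intro hull_minimal) auto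
  then show "z \<in> std_triangle \<Longrightarrow> 0 \<le> Re z \<and> 0 \<le> Im z \<and> Re z + Im z \<le> 1" by auto
qed

text \<open>On each side one of the three inequalities that cut out the triangle is an equality, and it is
  violated by a small step in the direction of \<open>1\<close>, \<open>-1\<close> or \<open>-\<i>\<close>.\<close>

lemma std_triangle_sides_not_interior:
  assumes "z \<in> closed_segment 0 1 \<union> closed_segment 1 \<i> \<union> closed_segment \<i> 0"
  shows "z \<notin> interior std_triangle"
proof
  assume "z \<in> interior std_triangle"
  then obtain e where e: "e > 0" "ball z e \<subseteq> std_triangle" by (auto simp: mem_interior)
  have near: "z + of_real (e/2) * w \<in> std_triangle" if "norm w = 1" for w
    using e that by (intro subsetD[OF e(2)]) (auto simp: dist_norm norm_mult)
  note c = std_triangle_coords[OF near]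
  from assms consider "Im z = 0" | "Re z + Im z = 1" | "Re z = 0"
    by (auto simp: closed_segment_def)
  then show False
    by cases (use c[of 1] c[of "- 1"] c[of "- \<i>"] e(1) in auto)
qed


section \<open>Triangles around edges and points\<close>

context sphere_triangulation
begin

lemma triangle_topology:
  assumes "t \<in> triangles T"
  shows "compact t" "connected t" "\<And>x. t \<noteq> {x}"
proof -
  obtain f f' where h: "homeomorphism std_triangle t f f'"
    using triangle_disc[OF assms] by blast
  have ft: "f ` std_triangle = t" and cf: "continuous_on std_triangle f"
    using h homeomorphism_image1 homeomorphism_cont1 by blast+
  have "compact std_triangle" unfolding std_triangle_def by (simp add: finite_imp_compact_convex_hull)
  then show "compact t" using compact_continuous_image cf ft by blast
  have "connected std_triangle" unfolding std_triangle_def by (simp add: convex_connected)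
  then show "connected t" using connected_continuous_image cf ft by blast
  have in01: "0 \<in> std_triangle" "1 \<in> std_triangle"
    unfolding std_triangle_def by (auto simp: hull_inc)
  then have ne: "f 0 \<noteq> f 1" using homeomorphism_apply1[OF h] by (metis zero_neq_one)
  have "f 0 \<in> t" "f 1 \<in> t" using in01 ft by auto
  with ne show "t \<noteq> {x}" for x by fastforce
qed

lemma triangle_islimpt: "t \<in> triangles T \<Longrightarrow> x \<in> t \<Longrightarrow> x islimpt t"
  by (intro connected_imp_perfect triangle_topology)

lemma triangle_subset_S2: "t \<in> triangles T \<Longrightarrow> t \<subseteq> S2"
  using triangles_cover by blast

lemma edge_topology:
  assumes "e \<in> edges T"
  shows "compact e" "infinite e" "\<exists>p q. p \<noteq> q \<and> points T \<inter> e = {p, q}"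
proof -
  obtain g where g: "arc g" "path_image g = e" "points T \<inter> e = {pathstart g, pathfinish g}"
    using edge_arc[OF assms] by blast
  show "compact e" using g by (metis compact_arc_image)
  have pq: "pathstart g \<noteq> pathfinish g" using arc_distinct_ends[OF g(1)] by metis
  then show "\<exists>p q. p \<noteq> q \<and> points T \<inter> e = {p, q}" using g(3) by blast
  have "connected e" using g by (metis connected_arc_image)
  moreover have "pathstart g \<in> e" "pathfinish g \<in> e" using g(3) by auto
  ultimately show "infinite e" using pq by (metis connected_finite_iff_sing empty_iff singletonD)
qed

lemma sides_edges: "e \<in> sides T t \<Longrightarrow> e \<in> edges T" "e \<in> sides T t \<Longrightarrow> e \<subseteq> t"
  by (auto simp: sides_def)

lemma std_triangle_corners: "0 \<in> std_triangle" "1 \<in> std_triangle" "\<i> \<in> std_triangle"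
  by (simp_all add: std_triangle_def hull_inc)

lemma std_triangle_segments:
  "closed_segment 0 1 \<subseteq> std_triangle" "closed_segment 1 \<i> \<subseteq> std_triangle"
  "closed_segment \<i> 0 \<subseteq> std_triangle"
  using std_triangle_corners unfolding std_triangle_def
  by (simp_all add: closed_segment_subset)

text \<open>Pulling everything back to the standard triangle shows that each of the three sides contains
  exactly two of the three nodes.\<close>

lemma triangle_nodes_sides:
  assumes "t \<in> triangles T"
  obtains a b c ea eb ec where "distinct [a, b, c]" "points T \<inter> t = {a, b, c}"
    "sides T t = {ea, eb, ec}"
    "points T \<inter> ea = {b, c}" "points T \<inter> eb = {a, c}" "points T \<inter> ec = {a, b}"
proof -
  obtain f f' where h: "homeomorphism std_triangle t f f'"
    and pt: "points T \<inter> t = {f 0, f 1, f \<i>}"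
    and st: "sides T t = {f ` closed_segment 0 1, f ` closed_segment 1 \<i>, f ` closed_segment \<i> 0}"
    using triangle_disc[OF assms] by blast
  have inj: "inj_on f std_triangle" using homeomorphism_apply1[OF h] by (auto intro: inj_on_inverseI)
  have "distinct [f 0, f 1, f \<i>]"
    using inj_on_eq_iff[OF inj] std_triangle_corners by auto
  moreover have seg: "points T \<inter> f ` S = f ` (S \<inter> {0, 1, \<i>})"
    if "f ` S \<in> sides T t" "S \<subseteq> std_triangle" for S
  proof -
    have "f ` S \<subseteq> t" using that(1) sides_edges by blast
    then have "points T \<inter> f ` S = f ` S \<inter> f ` {0, 1, \<i>}" using pt by auto
    also have "\<dots> = f ` (S \<inter> {0, 1, \<i>})"
      by (rule inj_on_image_Int[OF inj, symmetric]) (use that(2) std_triangle_corners in auto)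
    finally show ?thesis .
  qed
  have "\<i> \<notin> closed_segment 0 1" "0 \<notin> closed_segment 1 \<i>" "1 \<notin> closed_segment \<i> 0"
    by (auto simp: closed_segment_def complex_eq_iff)
  then have c: "closed_segment 0 1 \<inter> {0, 1, \<i>} = {0, 1}" "closed_segment 1 \<i> \<inter> {0, 1, \<i>} = {1, \<i>}"
    "closed_segment \<i> 0 \<inter> {0, 1, \<i>} = {0, \<i>}"
    by auto
  have "points T \<inter> f ` closed_segment 0 1 = {f 0, f 1}"
    "points T \<inter> f ` closed_segment 1 \<i> = {f 1, f \<i>}"
    "points T \<inter> f ` closed_segment \<i> 0 = {f 0, f \<i>}"
    using seg st std_triangle_segments by (simp_all add: c)
  ultimately show thesis
    using that[of "f 0" "f 1" "f \<i>" "f ` closed_segment 1 \<i>" "f ` closed_segment \<i> 0" "f ` closed_segment 0 1"]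
    using pt st by auto
qed

text \<open>Take a point of the side that is not a point of the triangulation. If no other triangle had this
  side, then no other triangle would contain that point, so the triangle would be a neighbourhood of
  it in the sphere. By invariance of domain the point would then be interior to the standard triangle
  as well, but it lies on its boundary.\<close>

lemma second_triangle_at_side:
  assumes t: "t \<in> triangles T" and e: "e \<in> sides T t"
  shows "\<exists>t'\<in>triangles T. t' \<noteq> t \<and> e \<in> sides T t'"
proof (rule ccontr)
  assume none: "\<not> ?thesis"
  have eE: "e \<in> edges T" using e sides_edges by blast
  obtain x where x: "x \<in> e" "x \<notin> points T"
    using edge_topology(2)[OF eE] finite_points by (meson finite_subset subsetI)
  have notin: "x \<notin> t'" if t': "t' \<in> triangles T" "t' \<noteq> t" for t'
  proof
    assume "x \<in> t'"
    moreover have "x \<in> t" using x e sides_edges by blast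
    ultimately obtain e' where e': "e' \<in> sides T t" "e' \<in> sides T t'" "x \<in> e'"
      using triangles_meet[OF t t'(1)] t'(2) x(2) by blast
    then have "e' = e" using edges_meet[OF eE, of e'] x sides_edges by blast
    then show False using none t' e' by blast
  qed
  define U where "U = S2 - \<Union>(triangles T - {t})"
  have "closed (\<Union>(triangles T - {t}))"
    using finite_triangles triangle_topology(1) by (intro closed_Union) (auto intro: compact_imp_closed)
  then have "openin (top_of_set S2) (S2 \<inter> - \<Union>(triangles T - {t}))"
    by (intro openin_open_Int) auto
  then have U: "openin (top_of_set S2) U" unfolding U_def by (simp add: Diff_eq)
  have Ut: "U \<subseteq> t" unfolding U_def using triangles_cover by blast
  have xU: "x \<in> U"
    unfolding U_def using notin x(1) e sides_edges triangle_subset_S2[OF t] by blast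
  obtain f f' where h: "homeomorphism std_triangle t f f'"
    and st: "sides T t = {f ` closed_segment 0 1, f ` closed_segment 1 \<i>, f ` closed_segment \<i> 0}"
    using triangle_disc[OF t] by blast
  have "f' ` U \<subseteq> interior (f' ` U)"
  proof (rule planar_image_of_open_in_S2[OF U])
    show "continuous_on U f'" using homeomorphism_cont2[OF h] Ut continuous_on_subset by blast
    show "inj_on f' U" using homeomorphism_apply2[OF h] Ut by (metis inj_on_inverseI subsetD)
  qed
  also have "\<dots> \<subseteq> interior std_triangle"
    using homeomorphism_image2[OF h] Ut by (intro interior_mono) blast
  finally have "f' x \<in> interior std_triangle" using xU by blast
  moreover obtain z where z: "x = f z" "z \<in> closed_segment 0 1 \<union> closed_segment 1 \<i> \<union> closed_segment \<i> 0"
    using st e x(1) by auto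
  have "z \<in> std_triangle" using z(2) std_triangle_segments by blast
  then have "f' x = z" unfolding z(1) by (rule homeomorphism_apply1[OF h])
  ultimately show False using std_triangle_sides_not_interior[OF z(2)] by simp
qed

definition cells :: "point set set"
  where "cells = triangles T \<union> edges T \<union> (\<lambda>q. {q}) ` points T"

text \<open>The complement in the sphere of the open star of \<open>p\<close>.\<close>

definition away :: "point \<Rightarrow> point set"
  where "away p = \<Union>{c \<in> cells. p \<notin> c}"

lemma closed_away: "closed (away p)"
proof -
  have "finite cells" unfolding cells_def using finite_points finite_edges finite_triangles by simp
  moreover have "closed c" if "c \<in> cells" for c
    using that triangle_topology(1) edge_topology(1) unfolding cells_def by (auto intro: compact_imp_closed)
  ultimately show ?thesis unfolding away_def by (intro closed_Union) auto
qed

lemma notin_away: "p \<notin> away p" by (auto simp: away_def)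

lemma in_away: "x \<in> c \<Longrightarrow> c \<in> cells \<Longrightarrow> p \<notin> c \<Longrightarrow> x \<in> away p" by (auto simp: away_def)

text \<open>If the triangles at \<open>p\<close> split into two families that share no edge at \<open>p\<close>, then close to \<open>p\<close> the
  unions of the two families meet in \<open>p\<close> only. They would disconnect every small punctured disc at
  \<open>p\<close>, since \<open>p\<close> is a limit point of each triangle that contains it.\<close>

lemma star_connected:
  assumes p: "p \<in> points T" and A: "A \<subseteq> {t \<in> triangles T. p \<in> t}" "A \<noteq> {}"
    and closed: "\<And>t t' e. \<lbrakk>t \<in> A; t' \<in> triangles T; e \<in> sides T t \<inter> sides T t'; p \<in> e\<rbrakk> \<Longrightarrow> t' \<in> A"
  shows "A = {t \<in> triangles T. p \<in> t}"
proof (rule ccontr)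
  assume ne: "A \<noteq> {t \<in> triangles T. p \<in> t}"
  define B where "B = {t \<in> triangles T. p \<in> t} - A"
  have B: "B \<noteq> {}" using A ne unfolding B_def by blast
  have cl: "closed (\<Union>A)" "closed (\<Union>B)"
    using A(1) B_def triangle_topology(1)
    by (intro closed_Union ballI compact_imp_closed finite_subset[OF _ finite_triangles]; blast)+
  have "openin (top_of_set S2) (S2 \<inter> - away p)"
    using closed_away by (intro openin_open_Int) auto
  moreover have "p \<in> S2 \<inter> - away p" using p points_on_sphere notin_away by blast
  ultimately obtain U where U: "openin (top_of_set S2) U" "p \<in> U" "U \<subseteq> S2 \<inter> - away p" "connected (U - {p})"
    by (rule punctured_neighbourhood_in_S2)
  have tri: "t \<in> A \<union> B" if "x \<in> U" "x \<in> t" "t \<in> triangles T" for x t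
    using that U(3) in_away[of x t p] unfolding B_def cells_def by blast
  have "U - {p} \<subseteq> \<Union>A \<union> \<Union>B"
    using U(3) tri triangles_cover by blast
  moreover have "\<Union>A \<inter> \<Union>B \<inter> (U - {p}) = {}"
  proof (rule ccontr)
    assume "\<Union>A \<inter> \<Union>B \<inter> (U - {p}) \<noteq> {}"
    then obtain x t t' where x: "x \<in> t" "t \<in> A" "x \<in> t'" "t' \<in> B" "x \<in> U" "x \<noteq> p" by blast
    have T: "t \<in> triangles T" "t' \<in> triangles T" "t \<noteq> t'" using x A B_def by blast+
    have xa: "x \<notin> away p" using x U(3) by blast
    have "x \<notin> points T" using in_away[of x "{x}" p] xa x(6) unfolding cells_def by blast
    then obtain e where e: "e \<in> sides T t \<inter> sides T t'" "x \<in> e" using triangles_meet[OF T] x by blast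
    then have "e \<in> cells" unfolding cells_def using sides_edges by blast
    then have "p \<in> e" using in_away e(2) xa by blast
    then show False using closed[OF x(2) T(2) e(1)] x(4) B_def by blast
  qed
  moreover have "\<Union>C \<inter> (U - {p}) \<noteq> {}" if C: "C \<noteq> {}" "C \<subseteq> {t \<in> triangles T. p \<in> t}" for C
  proof -
    obtain t where t: "t \<in> C" "t \<in> triangles T" "p \<in> t" using C by blast
    obtain S where S: "open S" "U = S2 \<inter> S" using U(1) unfolding openin_open by blast
    obtain y where "y \<in> t" "y \<in> S" "y \<noteq> p"
      using triangle_islimpt[OF t(2,3)] S U(2) unfolding islimpt_def by blast
    then show ?thesis using S t triangle_subset_S2 by blast
  qed
  ultimately show False
    using U(4) cl A B unfolding connected_closed B_def by (metis (no_types, lifting) Diff_subset)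
qed

end


section \<open>Gluing integer potentials over the sphere\<close>

text \<open>Maps from the sphere to the circle lift to the real line, because the sphere is simply
  connected.\<close>

lemma circle_valued_lift:
  fixes f :: "point \<Rightarrow> complex"
  assumes "continuous_on S2 f" "\<And>x. x \<in> S2 \<Longrightarrow> norm (f x) = 1"
  obtains h where "continuous_on S2 h" "\<And>x. x \<in> S2 \<Longrightarrow> f x = cis (h x)"
proof -
  have "Borsukian S2"
    by (intro simply_connected_imp_Borsukian simply_connected_sphere locally_path_connected_sphere) simp
  then obtain h where h: "continuous_on S2 (complex_of_real \<circ> h)" "\<forall>x\<in>S2. f x = exp (\<i> * of_real (h x))"
    unfolding Borsukian_continuous_logarithm_circle_real using assms by (force simp: Pi_iff)
  have "continuous_on S2 h" using h(1) by (simp add: o_def)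
  then show thesis using that h(2) by (simp add: cis_conv_exp)
qed

lemma integer_valued_continuous_constant:
  fixes f :: "'a :: topological_space \<Rightarrow> real"
  assumes "connected S" "continuous_on S f" "\<And>x. x \<in> S \<Longrightarrow> f x \<in> \<int>"
  shows "\<exists>n::int. \<forall>x\<in>S. f x = of_int n"
proof -
  have "f constant_on S"
  proof (rule continuous_discrete_range_constant[OF assms(1,2)])
    fix x assume "x \<in> S"
    have "1 \<le> norm (f y - f x)" if "y \<in> S" "f y \<noteq> f x" for y
      using assms(3)[OF that(1)] assms(3)[OF \<open>x \<in> S\<close>] that(2)
      by (auto elim!: Ints_cases simp flip: of_int_diff of_int_abs)
    then show "\<exists>e>0. \<forall>y. y \<in> S \<and> f y \<noteq> f x \<longrightarrow> e \<le> norm (f y - f x)"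
      by (intro exI[of _ 1]) auto
  qed
  then show ?thesis using assms(3) unfolding constant_on_def by (metis Ints_cases)
qed

context sphere_triangulation
begin

lemma away_nonempty:
  assumes "p \<in> points T" shows "away p \<noteq> {}"
proof -
  obtain t where t: "t \<in> triangles T" using triangles_cover assms points_on_sphere by blast
  obtain a b c ea eb ec where "distinct [a, b, c]" "points T \<inter> t = {a, b, c}"
    using triangle_nodes_sides[OF t] by metis
  then obtain q where "q \<in> points T" "q \<noteq> p" by auto
  then show ?thesis using in_away[of q "{q}" p] unfolding cells_def by blast
qed

text \<open>The open stars cover the sphere: \<open>x\<close> is in the open star of each node of the smallest cell that
  contains it. The proof treats points, edges and triangles in turn.\<close>

lemma near_some_point:
  assumes x: "x \<in> S2"
  shows "\<exists>p\<in>points T. x \<notin> away p"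
proof (cases "x \<in> points T")
  case True
  then show ?thesis using notin_away by blast
next
  case xP: False
  obtain t where t: "t \<in> triangles T" "x \<in> t" using x triangles_cover by blast
  show ?thesis
  proof (cases "\<exists>e\<in>edges T. x \<in> e")
    case True
    then obtain e where e: "e \<in> edges T" "x \<in> e" by blast
    obtain p q where p: "points T \<inter> e = {p, q}" using edge_topology(3)[OF e(1)] by blast
    obtain s where s: "s \<in> triangles T" "e \<in> sides T s" using edge_is_side[OF e(1)] by blast
    have "p \<in> c" if c: "c \<in> cells" "x \<in> c" for c
    proof -
      have edge: "p \<in> e'" if "e' \<in> edges T" "x \<in> e'" for e'
        using edges_meet[OF e(1) that(1)] that(2) e(2) xP p by blast
      have "p \<in> s'" if s': "s' \<in> triangles T" "x \<in> s'" for s'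
      proof (cases "s' = s")
        case True
        then show ?thesis using s(2) sides_edges p by blast
      next
        case False
        then obtain e' where "e' \<in> sides T s'" "x \<in> e'"
          using triangles_meet[OF s(1) s'(1)] s' xP s(2) sides_edges e(2) by blast
        then show ?thesis using edge sides_edges by blast
      qed
      then show ?thesis using c edge xP unfolding cells_def by blast
    qed
    then have "x \<notin> away p" unfolding away_def by blast
    then show ?thesis using p by blast
  next
    case noedge: False
    obtain p where p: "p \<in> points T" "p \<in> t"
      using triangle_nodes_sides[OF t(1)] by (metis IntD1 IntD2 insertI1)
    have "c = t" if c: "c \<in> cells" "x \<in> c" for c
    proof (rule ccontr)
      assume "c \<noteq> t"
      have "c \<in> triangles T" using c xP noedge unfolding cells_def by blast
      then have "x \<in> points T \<union> \<Union>(sides T c \<inter> sides T t)"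
        using triangles_meet[OF _ t(1) \<open>c \<noteq> t\<close>] c t by blast
      then show False using xP noedge sides_edges by blast
    qed
    then have "x \<notin> away p" unfolding away_def using p by blast
    then show ?thesis using p by blast
  qed
qed

text \<open>Here \<open>g t p\<close> is the value on the triangle \<open>t\<close> of an integer potential defined around the point
  \<open>p\<close>. The hypothesis says that the jump of the potential from one triangle to an adjacent one is
  the same at both ends of the common side, so the jumps are consistently defined. The conclusion is
  that they are the jumps of a function on all triangles, here \<open>- n\<close>.

  Blending the values \<open>g t p\<close> over the nodes of \<open>t\<close> with a partition of unity subordinate to the
  open stars gives a real function \<open>F t\<close> on \<open>t\<close>. On a common side only its two ends contribute, so \<open>F t - F t'\<close> is
  the integer jump there. Hence the functions \<open>F t\<close> induce one continuous map to the circle. Its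
  real logarithm, divided by \<open>2 * pi\<close>, differs from each \<open>F t\<close> by an integer constant, which is \<open>n t\<close>.\<close>

lemma local_potentials_glue:
  fixes g :: "point set \<Rightarrow> point \<Rightarrow> int"
  assumes g: "\<And>t t' e p q. \<lbrakk>t \<in> triangles T; t' \<in> triangles T; e \<in> sides T t \<inter> sides T t';
      p \<in> points T \<inter> e; q \<in> points T \<inter> e\<rbrakk> \<Longrightarrow> g t p - g t' p = g t q - g t' q"
  shows "\<exists>n. \<forall>t\<in>triangles T. \<forall>t'\<in>triangles T. \<forall>p\<in>points T \<inter> t \<inter> t'. n t + g t p = n t' + g t' p"
proof -
  define total where "total x = (\<Sum>q\<in>points T. infdist x (away q))" for x
  define \<phi> where "\<phi> p x = infdist x (away p) / total x" for p x
  have total: "total x > 0" if x: "x \<in> S2" for x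
  proof -
    obtain p where p: "p \<in> points T" "x \<notin> away p" using near_some_point[OF x] by blast
    then have "0 < infdist x (away p)"
      by (intro infdist_pos_not_in_closed closed_away away_nonempty)
    then show ?thesis unfolding total_def
      using p finite_points by (intro sum_pos2[of _ p]) (auto simp: infdist_nonneg)
  qed
  have \<phi>_cont: "continuous_on S2 (\<phi> p)" for p
    unfolding \<phi>_def using total
    by (intro continuous_on_divide continuous_on_infdist continuous_on_id)
       (auto simp: total_def[abs_def] less_imp_neq[symmetric] intro!: continuous_intros simp del: mem_sphere)
  have \<phi>_sum: "(\<Sum>p\<in>points T. \<phi> p x) = 1" if "x \<in> S2" for x
    using total[OF that] unfolding \<phi>_def by (simp flip: sum_divide_distrib add: total_def[symmetric])
  have \<phi>_0: "\<phi> p x = 0" if "x \<in> c" "c \<in> cells" "p \<notin> c" for x c p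
    unfolding \<phi>_def using in_away[OF that] by simp
  define F where "F t x = (\<Sum>p\<in>points T \<inter> t. \<phi> p x * of_int (g t p))" for t x
  have F_cell: "F t x = (\<Sum>p\<in>points T \<inter> c. \<phi> p x * of_int (g t p))"
    if "x \<in> c" "c \<in> cells" "c \<subseteq> t" for t x c
    unfolding F_def using that \<phi>_0[OF that(1,2)] finite_points
    by (intro sum.mono_neutral_right) auto
  have \<phi>_cell: "(\<Sum>p\<in>points T \<inter> c. \<phi> p x) = 1" if "x \<in> c" "c \<in> cells" "x \<in> S2" for x c
  proof -
    have "(\<Sum>p\<in>points T \<inter> c. \<phi> p x) = (\<Sum>p\<in>points T. \<phi> p x)"
      using \<phi>_0[OF that(1,2)] finite_points by (intro sum.mono_neutral_left) auto
    then show ?thesis using \<phi>_sum[OF that(3)] by simp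
  qed
  have F_diff: "F t x - F t' x \<in> \<int>"
    if t: "t \<in> triangles T" "x \<in> t" and t': "t' \<in> triangles T" "x \<in> t'" for t t' x
  proof (cases "t = t'")
    case False
    \<comment> \<open>The cell is a point or a common side; on either of them the jump is a constant integer.\<close>
    have "\<exists>c d. x \<in> c \<and> c \<in> cells \<and> c \<subseteq> t \<inter> t' \<and> (\<forall>p\<in>points T \<inter> c. g t p - g t' p = d)"
    proof (cases "x \<in> points T")
      case True
      then show ?thesis using t t' by (intro exI[of _ "{x}"] exI[of _ "g t x - g t' x"]) (auto simp: cells_def)
    next
      case xP: False
      then obtain e where e: "e \<in> sides T t \<inter> sides T t'" "x \<in> e"
        using triangles_meet[OF t(1) t'(1) False] t t' by blast
      obtain q where "q \<in> points T \<inter> e" using edge_topology(3)[of e] e sides_edges by blast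
      then have "\<forall>p\<in>points T \<inter> e. g t p - g t' p = g t q - g t' q" using g[OF t(1) t'(1) e(1)] by blast
      moreover have "e \<in> cells" "e \<subseteq> t \<inter> t'" unfolding cells_def using e sides_edges by blast+
      ultimately show ?thesis using e(2) by blast
    qed
    then obtain c d where c: "x \<in> c" "c \<in> cells" "c \<subseteq> t" "c \<subseteq> t'"
      and d: "\<forall>p\<in>points T \<inter> c. g t p - g t' p = d" by blast
    have "F t x - F t' x = (\<Sum>p\<in>points T \<inter> c. \<phi> p x * of_int (g t p - g t' p))"
      unfolding F_cell[OF c(1,2,3)] F_cell[OF c(1,2,4)] by (simp add: sum_subtractf algebra_simps)
    also have "\<dots> = (\<Sum>p\<in>points T \<inter> c. \<phi> p x * of_int d)" by (rule sum.cong[OF refl]) (simp only: d[rule_format])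
    also have "\<dots> = of_int d"
      using \<phi>_cell[OF c(1,2) subsetD[OF triangle_subset_S2[OF t(1)] t(2)]]
      by (simp only: sum_distrib_right[symmetric] mult_1)
    finally show ?thesis by simp
  qed simp
  \<comment> \<open>The choice of the triangle is immaterial, because the values differ by integers.\<close>
  define f where "f x = cis (2 * pi * F (SOME t. t \<in> triangles T \<and> x \<in> t) x)" for x
  have f: "f x = cis (2 * pi * F t x)" if t: "t \<in> triangles T" "x \<in> t" for t x
  proof -
    define s where "s = (SOME t. t \<in> triangles T \<and> x \<in> t)"
    have "s \<in> triangles T \<and> x \<in> s" unfolding s_def by (rule someI[of _ t]) (use t in simp)
    then have "F s x - F t x \<in> \<int>" using F_diff t by simp
    then have "cis (2 * pi * (F s x - F t x)) = 1" by (rule cis_multiple_2pi)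
    moreover have "f x = cis (2 * pi * (F s x - F t x)) * cis (2 * pi * F t x)"
      unfolding f_def cis_mult s_def by (simp add: algebra_simps)
    ultimately show ?thesis by simp
  qed
  have F_cont: "continuous_on t (F t)" if "t \<in> triangles T" for t
    unfolding F_def using triangle_subset_S2[OF that] \<phi>_cont
    by (intro continuous_intros) (auto intro: continuous_on_subset)
  have "continuous_on (\<Union>t\<in>triangles T. t) f"
  proof (rule continuous_on_closed_Union[OF finite_triangles])
    fix t assume t: "t \<in> triangles T"
    show "closed t" using triangle_topology(1)[OF t] compact_imp_closed by blast
    have "continuous_on t (\<lambda>x. cis (2 * pi * F t x))"
      by (intro continuous_intros F_cont[OF t])
    then show "continuous_on t f" using f[OF t] by (simp cong: continuous_on_cong)
  qed
  then have "continuous_on S2 f" using triangles_cover by simp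
  moreover have "norm (f x) = 1" for x unfolding f_def by simp
  ultimately obtain h where h: "continuous_on S2 h" "\<And>x. x \<in> S2 \<Longrightarrow> f x = cis (h x)"
    using circle_valued_lift by blast
  have "\<exists>n::int. \<forall>x\<in>t. h x / (2 * pi) - F t x = of_int n" if t: "t \<in> triangles T" for t
  proof (rule integer_valued_continuous_constant[OF triangle_topology(2)[OF t]])
    show "continuous_on t (\<lambda>x. h x / (2 * pi) - F t x)"
      using h(1) triangle_subset_S2[OF t]
      by (intro continuous_intros F_cont[OF t]) (auto intro: continuous_on_subset)
    fix x assume x: "x \<in> t"
    have "x \<in> S2" using triangle_subset_S2[OF t] x by (rule subsetD)
    then have "exp (\<i> * of_real (h x)) = exp (\<i> * of_real (2 * pi * F t x))"
      using f[OF t x] h(2) by (simp only: cis_conv_exp[symmetric])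
    then obtain k :: int
      where "\<i> * of_real (h x) = \<i> * of_real (2 * pi * F t x) + (of_int (2 * k) * pi) * \<i>"
      unfolding exp_eq by auto
    then have "h x = 2 * pi * F t x + 2 * pi * k"
      by (simp add: complex_eq_iff algebra_simps)
    then have "h x / (2 * pi) - F t x = of_int k" by (simp add: field_simps)
    then show "h x / (2 * pi) - F t x \<in> \<int>" by simp
  qed
  then obtain n :: "point set \<Rightarrow> int"
    where n: "\<And>t x. t \<in> triangles T \<Longrightarrow> x \<in> t \<Longrightarrow> h x / (2 * pi) - F t x = of_int (n t)"
    by metis
  have F_point: "F t p = of_int (g t p)" if "t \<in> triangles T" "p \<in> points T" "p \<in> t" for t p
  proof -
    have c: "p \<in> {p}" "{p} \<in> cells" "{p} \<subseteq> t" using that by (auto simp: cells_def)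
    have "points T \<inter> {p} = {p}" using that by auto
    then show ?thesis
      using F_cell[OF c] \<phi>_cell[OF c(1,2)] that points_on_sphere by auto
  qed
  have "n t + g t p = n t' + g t' p"
    if "t \<in> triangles T" "t' \<in> triangles T" "p \<in> points T \<inter> t \<inter> t'" for t t' p
  proof -
    have "real_of_int (n t + g t p) = of_int (n t' + g t' p)"
      using n[OF that(1), of p] n[OF that(2), of p] F_point that by auto
    then show ?thesis by linarith
  qed
  then show ?thesis by blast
qed

end


section \<open>Nodes, sides and neighbours of a triangle by color\<close>

lemma all_color: "(\<forall>\<mu>. P \<mu>) \<longleftrightarrow> P Red \<and> P Emerald \<and> P Violet"
  by (metis (full_types) color.exhaust)

lemma ex_color: "(\<exists>\<mu>. P \<mu>) \<longleftrightarrow> P Red \<or> P Emerald \<or> P Violet"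
  by (metis (full_types) color.exhaust)

lemma UNIV_color: "UNIV = {Red, Emerald, Violet}"
  by (auto simp: set_eq_iff all_color)

lemma color_neq_cases:
  "\<kappa> \<noteq> Violet \<Longrightarrow> \<exists>\<kappa>'. \<kappa>' \<noteq> Violet \<and> \<kappa>' \<noteq> \<kappa> \<and> (\<forall>\<mu>. \<mu> \<noteq> \<kappa> \<longrightarrow> \<mu> = Violet \<or> \<mu> = \<kappa>')"
  by (cases \<kappa>) (auto simp: ex_color all_color)

context trinity
begin

definition node :: "color \<Rightarrow> point set \<Rightarrow> point"
  where "node \<kappa> t = (THE p. p \<in> points T \<inter> t \<and> color_of T p = \<kappa>)"

text \<open>The color of an edge is the one missing among its ends, so the side of color \<open>\<kappa>\<close> is the one opposite
  to the node of color \<open>\<kappa>\<close>.\<close>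

definition side :: "color \<Rightarrow> point set \<Rightarrow> point set"
  where "side \<kappa> t = (THE e. e \<in> sides T t \<and> node \<kappa> t \<notin> e)"

definition across :: "color \<Rightarrow> point set \<Rightarrow> point set"
  where "across \<kappa> t = (THE t'. t' \<in> triangles T \<and> t' \<noteq> t \<and> side \<kappa> t \<in> sides T t')"

lemma triangle_colors_bij:
  assumes t: "t \<in> triangles T"
  shows "bij_betw (color_of T) (points T \<inter> t) UNIV"
proof -
  obtain a b c ea eb ec where abc: "distinct [a, b, c]" "points T \<inter> t = {a, b, c}"
    "sides T t = {ea, eb, ec}"
    "points T \<inter> ea = {b, c}" "points T \<inter> eb = {a, c}" "points T \<inter> ec = {a, b}"
    by (rule triangle_nodes_sides[OF t])
  have "ea \<in> edges T" "eb \<in> edges T" "ec \<in> edges T" using abc(3) sides_edges(1) by blast+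
  then have ne: "color_of T b \<noteq> color_of T c" "color_of T a \<noteq> color_of T c" "color_of T a \<noteq> color_of T b"
    using proper_coloring[of ea b c] proper_coloring[of eb a c] proper_coloring[of ec a b] abc
    by simp_all
  have inj: "inj_on (color_of T) {a, b, c}" using ne by (auto simp: inj_on_def)
  have U: "finite (UNIV :: color set)" "card (UNIV :: color set) = 3" by (simp_all add: UNIV_color)
  have "color_of T ` {a, b, c} = UNIV"
    by (rule card_subset_eq[OF U(1) subset_UNIV]) (use card_image[OF inj] abc(1) U(2) in simp)
  with inj show ?thesis unfolding abc(2) by (simp add: bij_betw_def)
qed

lemma node:
  assumes t: "t \<in> triangles T"
  shows "node \<kappa> t \<in> points T" "node \<kappa> t \<in> t" "color_of T (node \<kappa> t) = \<kappa>"
proof -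
  note B = triangle_colors_bij[OF t]
  have "\<kappa> \<in> color_of T ` (points T \<inter> t)" by (simp add: bij_betw_imp_surj_on[OF B])
  then obtain p where p: "p \<in> points T \<inter> t" "color_of T p = \<kappa>" by auto
  have "node \<kappa> t = p"
    unfolding node_def using p inj_onD[OF bij_betw_imp_inj_on[OF B]] by (intro the_equality) simp_all
  then show "node \<kappa> t \<in> points T" "node \<kappa> t \<in> t" "color_of T (node \<kappa> t) = \<kappa>"
    using p by simp_all
qed

lemma node_eqI:
  assumes t: "t \<in> triangles T" and p: "p \<in> points T" "p \<in> t"
  shows "node (color_of T p) t = p"
  by (rule inj_onD[OF bij_betw_imp_inj_on[OF triangle_colors_bij[OF t]]]) (simp_all add: node[OF t] p)

lemma node_iff:
  assumes "t \<in> triangles T" "p \<in> points T"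
  shows "p \<in> t \<longleftrightarrow> node (color_of T p) t = p"
  using node_eqI[OF assms] node(2)[OF assms(1), of "color_of T p"] by auto

lemma node_neq: "t \<in> triangles T \<Longrightarrow> node \<kappa> t = node \<kappa>' t \<longleftrightarrow> \<kappa> = \<kappa>'"
  by (metis node(3))

lemma points_in_triangle:
  assumes t: "t \<in> triangles T"
  shows "points T \<inter> t = range (\<lambda>\<kappa>. node \<kappa> t)"
proof
  show "points T \<inter> t \<subseteq> range (\<lambda>\<kappa>. node \<kappa> t)"
    using node_eqI[OF t, symmetric] by blast
qed (use node[OF t] in auto)

lemma sides_by_color:
  assumes t: "t \<in> triangles T"
  shows "\<exists>!e. e \<in> sides T t \<and> node \<kappa> t \<notin> e"
    and "e \<in> sides T t \<Longrightarrow> \<exists>\<kappa>. points T \<inter> e = points T \<inter> t - {node \<kappa> t}"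
proof -
  obtain a b c ea eb ec where abc: "distinct [a, b, c]" "points T \<inter> t = {a, b, c}"
    "sides T t = {ea, eb, ec}"
    "points T \<inter> ea = {b, c}" "points T \<inter> eb = {a, c}" "points T \<inter> ec = {a, b}"
    by (rule triangle_nodes_sides[OF t])
  have mem: "p \<in> ea \<longleftrightarrow> p = b \<or> p = c" "p \<in> eb \<longleftrightarrow> p = a \<or> p = c" "p \<in> ec \<longleftrightarrow> p = a \<or> p = b"
    if "p \<in> {a, b, c}" for p
    using that abc(2,4-6) by blast+
  have "node \<kappa> t \<in> {a, b, c}" using node[OF t, of \<kappa>] abc(2) by blast
  then show "\<exists>!e. e \<in> sides T t \<and> node \<kappa> t \<notin> e"
    using abc(1,3) mem[of "node \<kappa> t"] by auto
  have n: "\<exists>\<kappa>. node \<kappa> t = p" if "p \<in> {a, b, c}" for p using node_eqI[OF t] abc(2) that by blast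
  show "\<exists>\<kappa>. points T \<inter> e = points T \<inter> t - {node \<kappa> t}" if e: "e \<in> sides T t"
  proof -
    have "points T \<inter> ea = points T \<inter> t - {a}" "points T \<inter> eb = points T \<inter> t - {b}"
      "points T \<inter> ec = points T \<inter> t - {c}"
      using abc(1) unfolding abc(2,4-6) by auto
    then obtain p where p: "p \<in> {a,b,c}" "points T \<inter> e = points T \<inter> t - {p}"
      using e unfolding abc(3) by blast
    obtain \<kappa> where "node \<kappa> t = p" using n[OF p(1)] by (rule exE)
    then show ?thesis using p(2) by (intro exI[of _ \<kappa>]) simp
  qed
qed

lemma side:
  assumes t: "t \<in> triangles T"
  shows "side \<kappa> t \<in> sides T t" "node \<kappa> t \<notin> side \<kappa> t"
  using theI'[OF sides_by_color(1)[OF t, of \<kappa>]] unfolding side_def by auto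

lemma side_eqI:
  assumes "t \<in> triangles T" "e \<in> sides T t" "node \<kappa> t \<notin> e"
  shows "e = side \<kappa> t"
  using ex1E[OF sides_by_color(1)[OF assms(1), of \<kappa>]] side[OF assms(1), of \<kappa>] assms(2,3) by blast

lemma side_exists:
  assumes "t \<in> triangles T" "e \<in> sides T t"
  obtains \<kappa> where "e = side \<kappa> t"
proof -
  obtain \<kappa> where "points T \<inter> e = points T \<inter> t - {node \<kappa> t}" using sides_by_color(2)[OF assms] by blast
  then have "node \<kappa> t \<notin> e" using node(1)[OF assms(1), of \<kappa>] by blast
  then show thesis using that side_eqI[OF assms] by blast
qed

lemma points_on_side:
  assumes t: "t \<in> triangles T"
  shows "points T \<inter> side \<kappa> t = points T \<inter> t - {node \<kappa> t}"
proof -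
  obtain \<kappa>' where \<kappa>': "points T \<inter> side \<kappa> t = points T \<inter> t - {node \<kappa>' t}"
    using sides_by_color(2)[OF t side(1)[OF t]] by blast
  then have "node \<kappa> t = node \<kappa>' t" using node[OF t, of \<kappa>] side(2)[OF t, of \<kappa>] by blast
  then show ?thesis using \<kappa>' by simp
qed

lemma node_in_side: "t \<in> triangles T \<Longrightarrow> node \<kappa>' t \<in> side \<kappa> t \<longleftrightarrow> \<kappa>' \<noteq> \<kappa>"
  using points_on_side[of t \<kappa>] node[of t \<kappa>'] node_neq[of t \<kappa>' \<kappa>] by auto

lemma next_node_cases:
  assumes t: "t \<in> triangles T"
  shows "next_node T t (node Red t) = node Emerald t \<and> next_node T t (node Emerald t) = node Violet t
      \<and> next_node T t (node Violet t) = node Red t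
    \<or> next_node T t (node Red t) = node Violet t \<and> next_node T t (node Violet t) = node Emerald t
      \<and> next_node T t (node Emerald t) = node Red t"
proof -
  obtain a b c where abc: "distinct [a, b, c]" "points T \<inter> t = {a, b, c}"
    "next_node T t a = b" "next_node T t b = c" "next_node T t c = a"
    using cyclic_order[OF t] by blast
  have mem: "node \<kappa> t = a \<or> node \<kappa> t = b \<or> node \<kappa> t = c" for \<kappa> using node[OF t] abc(2) by blast
  have "node Red t \<noteq> node Emerald t" "node Red t \<noteq> node Violet t" "node Emerald t \<noteq> node Violet t"
    by (simp_all add: node_neq[OF t])
  then show ?thesis using mem[of Red] mem[of Emerald] mem[of Violet] abc(1,3-5)
    by (elim disjE) simp_all
qed

lemma white_iff:
  assumes t: "t \<in> triangles T"
  shows "t \<in> white T \<longleftrightarrow> next_node T t (node Red t) = node Emerald t"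
proof
  assume "t \<in> white T"
  then obtain r e where "r \<in> t \<inter> color_class T Red" "e \<in> t \<inter> color_class T Emerald" "next_node T t r = e"
    unfolding white_def by blast
  then show "next_node T t (node Red t) = node Emerald t"
    using node_eqI[OF t, of r] node_eqI[OF t, of e] by (simp add: color_class_def)
next
  assume "next_node T t (node Red t) = node Emerald t"
  then have "next_node T t (node Emerald t) = node Violet t \<and> next_node T t (node Violet t) = node Red t"
    using next_node_cases[OF t] node_neq[OF t] by auto
  moreover have "node \<kappa> t \<in> t \<inter> color_class T \<kappa>" for \<kappa> using node[OF t] by (simp add: color_class_def)
  ultimately show "t \<in> white T"
    unfolding white_def using t \<open>next_node T t (node Red t) = node Emerald t\<close> by blast
qed

lemma next_node_on_side:
  assumes t: "t \<in> triangles T" and pq: "p \<in> points T \<inter> t" "q \<in> points T \<inter> t" "p \<noteq> q"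
  shows "next_node T t p = q \<longleftrightarrow> next_node T t q \<noteq> p"
proof -
  obtain a b c where "distinct [a, b, c]" "points T \<inter> t = {a, b, c}"
    "next_node T t a = b" "next_node T t b = c" "next_node T t c = a"
    using cyclic_order[OF t] by blast
  then show ?thesis using pq by auto
qed

text \<open>Coherence as an equivalence. In this form it rules out a third triangle at a side, since three truth
  values cannot be pairwise different, and it makes the two triangles at a side differ in color.\<close>

lemma coherent_iff:
  assumes t: "t \<in> triangles T" "t' \<in> triangles T" "t \<noteq> t'" and e: "e \<in> sides T t" "e \<in> sides T t'"
    and pq: "points T \<inter> e = {p, q}" "p \<noteq> q"
  shows "next_node T t p = q \<longleftrightarrow> next_node T t' p \<noteq> q"
proof -
  have "p \<in> points T \<inter> t" "q \<in> points T \<inter> t" "p \<in> points T \<inter> t'" "q \<in> points T \<inter> t'"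
    using pq(1) sides_edges(2)[OF e(1)] sides_edges(2)[OF e(2)] by blast+
  note n = next_node_on_side[OF t(1) this(1,2) pq(2)] next_node_on_side[OF t(2) this(3,4) pq(2)]
  have qp: "points T \<inter> e = {q, p}" using pq(1) by auto
  have "next_node T t p = q \<Longrightarrow> next_node T t' q = p" "next_node T t q = p \<Longrightarrow> next_node T t' p = q"
    using coherent[OF t _ pq(1)] coherent[OF t _ qp] e by blast+
  then show ?thesis using n by blast
qed

lemma at_most_two_triangles:
  assumes t: "t \<in> triangles T" "t' \<in> triangles T" "t'' \<in> triangles T"
    and ne: "t \<noteq> t'" "t \<noteq> t''" "t' \<noteq> t''"
    and e: "e \<in> sides T t" "e \<in> sides T t'" "e \<in> sides T t''"
  shows False
proof -
  obtain p q where pq: "p \<noteq> q" "points T \<inter> e = {p, q}"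
    using edge_topology(3)[OF sides_edges(1)[OF e(1)]] by blast
  show False
    using coherent_iff[OF t(1,2) ne(1) e(1,2) pq(2,1)] coherent_iff[OF t(1,3) ne(2) e(1,3) pq(2,1)]
      coherent_iff[OF t(2,3) ne(3) e(2,3) pq(2,1)] by blast
qed

lemma across:
  assumes t: "t \<in> triangles T"
  shows "across \<kappa> t \<in> triangles T" "across \<kappa> t \<noteq> t" "side \<kappa> t \<in> sides T (across \<kappa> t)"
proof -
  have "\<exists>!t'. t' \<in> triangles T \<and> t' \<noteq> t \<and> side \<kappa> t \<in> sides T t'"
    using second_triangle_at_side[OF t side(1)[OF t, of \<kappa>]]
      at_most_two_triangles[OF t _ _ _ _ _ side(1)[OF t, of \<kappa>]] by (blast dest: sym)
  from theI'[OF this] show "across \<kappa> t \<in> triangles T" "across \<kappa> t \<noteq> t" "side \<kappa> t \<in> sides T (across \<kappa> t)"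
    unfolding across_def by auto
qed

lemma across_eqI: "\<lbrakk>t \<in> triangles T; t' \<in> triangles T; t' \<noteq> t; side \<kappa> t \<in> sides T t'\<rbrakk> \<Longrightarrow> t' = across \<kappa> t"
  using across[of t \<kappa>] at_most_two_triangles[of t t' "across \<kappa> t" "side \<kappa> t"] side(1)[of t \<kappa>] by auto

lemma node_across:
  assumes t: "t \<in> triangles T" and \<kappa>: "\<kappa>' \<noteq> \<kappa>"
  shows "node \<kappa>' (across \<kappa> t) = node \<kappa>' t"
proof -
  have "node \<kappa>' t \<in> across \<kappa> t"
    using node_in_side[OF t] \<kappa> across(3)[OF t] sides_edges(2) by blast
  then show ?thesis using node_eqI[OF across(1)[OF t] node(1)[OF t], of \<kappa>' \<kappa>] node(3)[OF t] by simp
qed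

lemma side_across: 
  assumes t: "t \<in> triangles T"
  shows "side \<kappa> (across \<kappa> t) = side \<kappa> t"
proof (rule side_eqI[symmetric, OF across(1,3)[OF t]])
  show "node \<kappa> (across \<kappa> t) \<notin> side \<kappa> t"
  proof
    assume "node \<kappa> (across \<kappa> t) \<in> side \<kappa> t"
    then have "node \<kappa> (across \<kappa> t) \<in> points T \<inter> t - {node \<kappa> t}"
      using points_on_side[OF t] node(1)[OF across(1)[OF t]] by blast
    then show False
      using node_eqI[OF t, of "node \<kappa> (across \<kappa> t)"] node(3)[OF across(1)[OF t], of \<kappa> \<kappa>] by auto
  qed
qed

lemma across_across: "t \<in> triangles T \<Longrightarrow> across \<kappa> (across \<kappa> t) = t"
  by (rule across_eqI[symmetric]) (simp_all add: across side_across side(1) across(2)[symmetric])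

text \<open>Crossing a side keeps its two ends with their colors but reverses the direction, and a triangle is
  white if and only if it runs along any one of its sides in the order red, emerald, violet.\<close>

lemma across_white_iff:
  assumes t: "t \<in> triangles T"
  shows "across \<kappa> t \<in> white T \<longleftrightarrow> t \<notin> white T"
proof -
  let ?t = "across \<kappa> t"
  note t' = across(1)[OF t, of \<kappa>]
  have c: "next_node T t p = q \<longleftrightarrow> next_node T ?t p \<noteq> q"
    if "points T \<inter> t - {node \<kappa> t} = {p, q}" "p \<noteq> q" for p q
    using coherent_iff[OF t t' across(2)[OF t, symmetric] side(1)[OF t] across(3)[OF t]] that points_on_side[OF t]
    by auto
  have U: "points T \<inter> t = {node Red t, node Emerald t, node Violet t}"
    by (simp add: points_in_triangle[OF t] UNIV_color)
  note ne = node_neq[OF t] node_neq[OF t']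
  note cs = next_node_cases[OF t] next_node_cases[OF t']
  note w = white_iff[OF t] white_iff[OF t']
  have same: "node \<kappa>' ?t = node \<kappa>' t" if "\<kappa>' \<noteq> \<kappa>" for \<kappa>' using node_across[OF t that] .
  show ?thesis
  proof (cases \<kappa>)
    case Red
    have p: "points T \<inter> t - {node \<kappa> t} = {node Emerald t, node Violet t}"
      unfolding U using Red ne by auto
    show ?thesis using c[OF p] same[of Emerald] same[of Violet] cs ne Red unfolding w by auto
  next
    case Emerald
    have p: "points T \<inter> t - {node \<kappa> t} = {node Red t, node Violet t}"
      unfolding U using Emerald ne by auto
    show ?thesis using c[OF p] same[of Red] same[of Violet] cs ne Emerald unfolding w by auto
  next
    case Violet
    have p: "points T \<inter> t - {node \<kappa> t} = {node Red t, node Emerald t}"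
      unfolding U using Violet ne by auto
    show ?thesis using c[OF p] same[of Red] same[of Emerald] cs ne Violet unfolding w by auto
  qed
qed

lemma white_triangle: "t \<in> white T \<Longrightarrow> t \<in> triangles T"
  by (simp add: white_def)

lemma finite_white: "finite (white T)"
  using finite_triangles by (simp add: white_def)

lemma adjacent_triangles:
  assumes "t \<in> triangles T" "t' \<in> triangles T" "t \<noteq> t'" "e \<in> sides T t \<inter> sides T t'"
  obtains \<kappa> where "e = side \<kappa> t" "t' = across \<kappa> t"
proof -
  obtain \<kappa> where "e = side \<kappa> t" using side_exists assms by blast
  then show thesis using that across_eqI[of t t' \<kappa>] assms by blast
qed

lemma star_connected_across:
  assumes p: "p \<in> points T" and A: "A \<subseteq> {t \<in> triangles T. p \<in> t}" "A \<noteq> {}"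
    and closed: "\<And>t \<kappa>. t \<in> A \<Longrightarrow> \<kappa> \<noteq> color_of T p \<Longrightarrow> across \<kappa> t \<in> A"
  shows "A = {t \<in> triangles T. p \<in> t}"
proof (rule star_connected[OF p A])
  fix t t' e assume t: "t \<in> A" "t' \<in> triangles T" "e \<in> sides T t \<inter> sides T t'" "p \<in> e"
  have tT: "t \<in> triangles T" "p \<in> t" using t(1) A by blast+
  show "t' \<in> A"
  proof (cases "t' = t")
    case False
    then obtain \<kappa> where \<kappa>: "e = side \<kappa> t" "t' = across \<kappa> t"
      using adjacent_triangles[OF tT(1) t(2) _ t(3)] by metis
    then have "node (color_of T p) t \<in> side \<kappa> t" using t(4) node_eqI[OF tT(1) p tT(2)] by simp
    then show ?thesis using closed[OF t(1)] \<kappa> node_in_side[OF tT(1)] by blast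
  qed (use t in simp)
qed

end


section \<open>Balanced weights on the white triangles are coboundaries\<close>

text \<open>Write \<open>\<delta> x\<close> for the indicator function of \<open>x\<close>. The functions that are coboundaries along \<open>\<sigma>\<close> form
  a group, which contains \<open>\<delta> x - \<delta> (\<sigma> x)\<close> for every \<open>x\<close>. By transitivity it contains
  \<open>\<delta> x - \<delta> w0\<close> for all \<open>x\<close>, and these generate the functions of sum zero.\<close>

lemma transitive_permutation_coboundary:
  fixes c :: "'a \<Rightarrow> int"
  assumes W: "finite W" and \<sigma>: "inj_on \<sigma> W" "\<sigma> ` W \<subseteq> W"
    and trans: "\<And>A. \<lbrakk>A \<subseteq> W; A \<noteq> {}; \<sigma> ` A \<subseteq> A\<rbrakk> \<Longrightarrow> A = W"
    and c: "sum c W = 0"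
  shows "\<exists>G. \<forall>w\<in>W. G (\<sigma> w) - G w = c w"
proof (cases "W = {}")
  case False
  then obtain w0 where w0: "w0 \<in> W" by blast
  define \<delta> :: "'a \<Rightarrow> 'a \<Rightarrow> int" where "\<delta> x w = of_bool (w = x)" for x w
  define A where "A = {x \<in> W. \<exists>G. \<forall>w\<in>W. G (\<sigma> w) - G w = \<delta> x w - \<delta> w0 w}"
  have "A = W"
  proof (rule trans)
    have "w0 \<in> A" unfolding A_def using w0 by (auto intro!: exI[of _ "\<lambda>_. 0"])
    then show "A \<noteq> {}" by blast
    show "\<sigma> ` A \<subseteq> A"
    proof
      fix y assume "y \<in> \<sigma> ` A"
      then obtain x G where x: "y = \<sigma> x" "x \<in> W" and G: "\<forall>w\<in>W. G (\<sigma> w) - G w = \<delta> x w - \<delta> w0 w"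
        unfolding A_def by auto
      have "G (\<sigma> w) - \<delta> y (\<sigma> w) - (G w - \<delta> y w) = \<delta> y w - \<delta> w0 w" if "w \<in> W" for w
        using G that inj_on_eq_iff[OF \<sigma>(1) that x(2)] by (auto simp: \<delta>_def x(1))
      then show "y \<in> A" unfolding A_def using x \<sigma>(2) by (auto intro!: exI[of _ "\<lambda>w. G w - \<delta> y w"])
    qed
  qed (auto simp: A_def)
  then have "\<forall>x\<in>W. \<exists>G. \<forall>w\<in>W. G (\<sigma> w) - G w = \<delta> x w - \<delta> w0 w" unfolding A_def by blast
  then obtain G where G: "\<And>x w. x \<in> W \<Longrightarrow> w \<in> W \<Longrightarrow> G x (\<sigma> w) - G x w = \<delta> x w - \<delta> w0 w"
    by metis
  have "(\<Sum>x\<in>W. c x * G x (\<sigma> w)) - (\<Sum>x\<in>W. c x * G x w) = c w" if w: "w \<in> W" for w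
  proof -
    have "(\<Sum>x\<in>W. c x * G x (\<sigma> w)) - (\<Sum>x\<in>W. c x * G x w) = (\<Sum>x\<in>W. c x * (\<delta> x w - \<delta> w0 w))"
      unfolding sum_subtractf[symmetric] right_diff_distrib[symmetric]
      by (intro sum.cong refl) (simp only: G w)
    also have "\<dots> = (\<Sum>x\<in>W. c x * \<delta> x w) - sum c W * \<delta> w0 w"
      by (simp add: right_diff_distrib sum_subtractf sum_distrib_right)
    also have "\<dots> = c w" using c W w by (simp add: \<delta>_def)
    finally show ?thesis .
  qed
  then show ?thesis by (intro exI[of _ "\<lambda>w. \<Sum>x\<in>W. c x * G x w"]) simp
qed simp

context trinity
begin

definition white_at :: "point \<Rightarrow> point set set"
  where "white_at p = {w \<in> white T. p \<in> w}"

lemma finite_white_at: "finite (white_at p)" by (simp add: white_at_def finite_white)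

lemma across_in_star:
  assumes "t \<in> triangles T" "p \<in> points T" "\<kappa> \<noteq> color_of T p"
  shows "p \<in> across \<kappa> t \<longleftrightarrow> p \<in> t"
  using node_iff[OF assms(1,2)] node_iff[OF across(1)[OF assms(1)] assms(2)] node_across[OF assms(1) assms(3)[symmetric]]
  by simp

lemma bij_betw_across:
  assumes p: "p \<in> points T" "\<kappa> \<noteq> color_of T p"
  shows "bij_betw (across \<kappa>) (white_at p) {b \<in> triangles T - white T. p \<in> b}"
  by (rule bij_betw_byWitness[of _ "across \<kappa>"])
     (auto simp: white_at_def white_triangle across_across across across_white_iff across_in_star p)

text \<open>Both sums run over the black triangles at \<open>p\<close>, which are indexed by the white ones through the edges
  at \<open>p\<close> of either color.\<close>

lemma sum_across:
  assumes "p \<in> points T" "\<kappa> \<noteq> color_of T p" "\<kappa>' \<noteq> color_of T p"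
  shows "(\<Sum>w\<in>white_at p. F (across \<kappa> w)) = (\<Sum>w\<in>white_at p. F (across \<kappa>' w))"
  using sum.reindex_bij_betw[OF bij_betw_across[OF assms(1,2)], of F]
    sum.reindex_bij_betw[OF bij_betw_across[OF assms(1,3)], of F] by simp

text \<open>A function on the triangles at \<open>p\<close> with prescribed jumps across the edges at \<open>p\<close>: the jump
  is \<open>c\<close> across violet edges and \<open>0\<close> across the others. At a violet point a constant works. At any
  other point, edges of color violet and of one further color \<open>\<kappa>'\<close> alternate; going from a white
  triangle to the next white one crosses one edge of each color. This is a permutation \<open>\<sigma>\<close> of the
  white triangles at \<open>p\<close>, transitive because the star is connected, and the prescribed total jump
  along its only cycle is the sum of \<open>c\<close>.\<close>

lemma potential_at_point:
  fixes c :: "point set \<Rightarrow> int"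
  assumes p: "p \<in> points T" and c: "color_of T p \<noteq> Violet \<Longrightarrow> sum c (white_at p) = 0"
  shows "\<exists>G. \<forall>w\<in>white_at p. \<forall>\<kappa>. \<kappa> \<noteq> color_of T p \<longrightarrow> G w - G (across \<kappa> w) = (if \<kappa> = Violet then c w else 0)"
proof (cases "color_of T p = Violet")
  case True
  then show ?thesis by (intro exI[of _ "\<lambda>_. 0"]) simp
next
  case False
  then obtain \<kappa>' where \<kappa>': "\<kappa>' \<noteq> Violet" "\<kappa>' \<noteq> color_of T p"
    and \<kappa>: "\<And>\<mu>. \<mu> \<noteq> color_of T p \<Longrightarrow> \<mu> = Violet \<or> \<mu> = \<kappa>'" using color_neq_cases[OF False] by blast
  let ?W = "white_at p"
  define \<sigma> where "\<sigma> w = across Violet (across \<kappa>' w)" for w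
  have W: "w \<in> ?W \<longleftrightarrow> w \<in> triangles T \<and> p \<in> w \<and> w \<in> white T" for w
    by (auto simp: white_at_def white_triangle)
  have \<sigma>: "\<sigma> w \<in> ?W" if "w \<in> ?W" for w
    using that False \<kappa>' by (simp add: W \<sigma>_def across across_white_iff across_in_star p)
  have \<sigma>': "across \<kappa>' (across Violet w) \<in> ?W" "\<sigma> (across \<kappa>' (across Violet w)) = w" if "w \<in> ?W" for w
    using that False \<kappa>' by (simp_all add: W \<sigma>_def across across_white_iff across_in_star p across_across)
  have inj: "inj_on \<sigma> ?W"
    by (rule inj_on_inverseI[of _ "\<lambda>w. across \<kappa>' (across Violet w)"]) (simp add: W \<sigma>_def across across_across)
  have bij: "bij_betw \<sigma> ?W ?W"
    unfolding bij_betw_def using inj \<sigma> \<sigma>' by (auto simp: image_iff) metis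
  have "\<exists>G. \<forall>w\<in>?W. G (\<sigma> w) - G w = c (\<sigma> w)"
  proof (rule transitive_permutation_coboundary[OF finite_white_at inj])
    show "\<sigma> ` ?W \<subseteq> ?W" using \<sigma> by blast
    show "(\<Sum>w\<in>?W. c (\<sigma> w)) = 0"
      using c[OF False] sum.reindex_bij_betw[OF bij, of c] by simp
    fix A assume A: "A \<subseteq> ?W" "A \<noteq> {}" "\<sigma> ` A \<subseteq> A"
    have "finite A" using A(1) finite_white_at finite_subset by blast
    then have \<sigma>A: "\<sigma> ` A = A"
      using A inj by (meson endo_inj_surj inj_on_subset)
    have tri: "a \<in> triangles T" "p \<in> a" "a \<in> white T" if "a \<in> A" for a using A(1) W that by blast+
    have "A \<union> across \<kappa>' ` A = {t \<in> triangles T. p \<in> t}"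
    proof (rule star_connected_across[OF p])
      show "A \<union> across \<kappa>' ` A \<subseteq> {t \<in> triangles T. p \<in> t}"
        using \<kappa>' by (auto simp: tri across across_in_star p)
      show "A \<union> across \<kappa>' ` A \<noteq> {}" using A(2) by simp
      fix t \<kappa> assume t: "t \<in> A \<union> across \<kappa>' ` A" and k: "\<kappa> \<noteq> color_of T p"
      then consider "\<kappa> = \<kappa>'" | "\<kappa> = Violet" using \<kappa> by blast
      then show "across \<kappa> t \<in> A \<union> across \<kappa>' ` A"
      proof cases
        case 1
        then show ?thesis using t tri across_across by auto
      next
        case 2
        show ?thesis
        proof (cases "t \<in> A")
          case True
          then obtain a where "a \<in> A" "t = \<sigma> a" using \<sigma>A by blast
          then have "across Violet t = across \<kappa>' a" using tri(1)[OF \<open>a \<in> A\<close>] by (simp add: \<sigma>_def across across_across)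
          then show ?thesis using \<open>a \<in> A\<close> 2 by blast
        next
          case False
          then obtain a where "a \<in> A" "t = across \<kappa>' a" using t by blast
          then have "across Violet t = \<sigma> a" by (simp add: \<sigma>_def)
          then show ?thesis using \<open>a \<in> A\<close> 2 A(3) by blast
        qed
      qed
    qed
    moreover have "across \<kappa>' a \<notin> white T" if "a \<in> A" for a using tri[OF that] by (simp add: across_white_iff)
    ultimately show "A = ?W" using A(1) by (auto simp: W)
  qed
  then obtain G where G: "\<And>w. w \<in> ?W \<Longrightarrow> G (\<sigma> w) - G w = c (\<sigma> w)" by blast
  \<comment> \<open>A black triangle takes the value of the white one next to it across \<open>\<kappa>'\<close>, where the jump is \<open>0\<close>.\<close>
  define H where "H t = (if t \<in> white T then G t else G (across \<kappa>' t))" for t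
  have "H w - H (across \<kappa> w) = (if \<kappa> = Violet then c w else 0)"
    if w: "w \<in> ?W" and k: "\<kappa> \<noteq> color_of T p" for w \<kappa>
  proof (cases "\<kappa> = Violet")
    case True
    then show ?thesis using G[OF \<sigma>'(1)[OF w]] \<sigma>'(2)[OF w] w by (simp add: H_def W across_white_iff)
  next
    case False
    then have "\<kappa> = \<kappa>'" using \<kappa> k by blast
    then show ?thesis using w \<kappa>' by (simp add: H_def W across_white_iff across_across)
  qed
  then show ?thesis by blast
qed

text \<open>The potentials around the points glue to a function \<open>n\<close> on the triangles that changes by \<open>c\<close>
  across violet edges and does not change across the other edges. All edges at a violet point are
  of the latter kind, so \<open>n\<close> is constant on the star of each violet point and defines \<open>z\<close> there.\<close>

lemma balanced_imp_coboundary: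
  fixes c :: "point set \<Rightarrow> int"
  assumes c: "\<And>p. p \<in> points T \<Longrightarrow> color_of T p \<noteq> Violet \<Longrightarrow> sum c (white_at p) = 0"
  shows "\<exists>z. \<forall>w\<in>white T. c w = z (node Violet (across Violet w)) - z (node Violet w)"
proof -
  define J where "J \<kappa> w = (if \<kappa> = Violet then c w else 0)" for \<kappa> w
  have "\<forall>p. \<exists>G. p \<in> points T \<longrightarrow> (\<forall>w\<in>white_at p. \<forall>\<kappa>. \<kappa> \<noteq> color_of T p \<longrightarrow> G w - G (across \<kappa> w) = J \<kappa> w)"
    using potential_at_point c unfolding J_def by blast
  from choice[OF this] obtain g' where g': "\<And>p. p \<in> points T \<longrightarrow>
      (\<forall>w\<in>white_at p. \<forall>\<kappa>. \<kappa> \<noteq> color_of T p \<longrightarrow> g' p w - g' p (across \<kappa> w) = J \<kappa> w)"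
    by blast
  define g where "g t p = g' p t" for t p
  have gw: "g w p - g (across \<kappa> w) p = J \<kappa> w"
    if "w \<in> white T" "p \<in> points T" "p \<in> w" "\<kappa> \<noteq> color_of T p" for w p \<kappa>
    using g'[of p] that unfolding g_def white_at_def by blast
  have "\<exists>n. \<forall>t\<in>triangles T. \<forall>t'\<in>triangles T. \<forall>p\<in>points T \<inter> t \<inter> t'. n t + g t p = n t' + g t' p"
  proof (rule local_potentials_glue)
    fix t t' e p q
    assume t: "t \<in> triangles T" "t' \<in> triangles T" and e: "e \<in> sides T t \<inter> sides T t'"
      and p: "p \<in> points T \<inter> e" "q \<in> points T \<inter> e"
    have in_e: "x \<in> t" "x \<in> t'" if "x \<in> points T \<inter> e" for x using that e sides_edges(2) by blast+
    show "g t p - g t' p = g t q - g t' q"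
    proof (cases "t = t'")
      case False
      then obtain \<kappa> where \<kappa>: "e = side \<kappa> t" "t' = across \<kappa> t"
        using adjacent_triangles[OF t False e] by metis
      have ne: "\<kappa> \<noteq> color_of T x" if "x \<in> points T \<inter> e" for x
        using that node_in_side[OF t(1), of "color_of T x" \<kappa>] node_eqI[OF t(1)] in_e \<kappa>(1) by auto
      show ?thesis
      proof (cases "t \<in> white T")
        case True
        then show ?thesis using gw[of t p \<kappa>] gw[of t q \<kappa>] p ne in_e \<kappa>(2) by simp
      next
        case False
        then have "t' \<in> white T" "across \<kappa> t' = t" using \<kappa>(2) across_white_iff[OF t(1)] across_across[OF t(1)] by simp_all
        then show ?thesis using gw[of t' p \<kappa>] gw[of t' q \<kappa>] p ne in_e by simp
      qed
    qed simp
  qed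
  then obtain n where n: "\<And>t t' p. \<lbrakk>t \<in> triangles T; t' \<in> triangles T; p \<in> points T; p \<in> t; p \<in> t'\<rbrakk>
      \<Longrightarrow> n t + g t p = n t' + g t' p" by blast
  have n_across: "n (across \<kappa> w) - n w = J \<kappa> w" if w: "w \<in> white T" for w \<kappa>
  proof -
    obtain \<kappa>' :: color where \<kappa>': "\<kappa>' \<noteq> \<kappa>" by (metis color.distinct(1))
    have wT: "w \<in> triangles T" using w by (rule white_triangle)
    let ?p = "node \<kappa>' w"
    have "?p \<in> across \<kappa> w" using node(2)[OF across(1)[OF wT], of \<kappa>' \<kappa>] node_across[OF wT \<kappa>'] by simp
    then have "n w + g w ?p = n (across \<kappa> w) + g (across \<kappa> w) ?p"
      using n[OF wT across(1)[OF wT] node(1,2)[OF wT]] by blast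
    moreover have "g w ?p - g (across \<kappa> w) ?p = J \<kappa> w"
      by (rule gw[OF w node(1,2)[OF wT]]) (use \<kappa>' node(3)[OF wT] in simp)
    ultimately show ?thesis by linarith
  qed
  have n_const: "n (across \<kappa> t) = n t" if "t \<in> triangles T" "\<kappa> \<noteq> Violet" for t \<kappa>
    using n_across[of t \<kappa>] n_across[of "across \<kappa> t" \<kappa>] across_white_iff[of t \<kappa>] across_across[of t \<kappa>] that by (auto simp: J_def)
  define z where "z v = n (SOME t. t \<in> triangles T \<and> v \<in> t)" for v
  have z: "n t = z (node Violet t)" if t: "t \<in> triangles T" for t
  proof -
    let ?v = "node Violet t" and ?s = "SOME s. s \<in> triangles T \<and> node Violet t \<in> s"
    have v: "?v \<in> points T" "color_of T ?v = Violet" using node[OF t] by auto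
    have s: "?s \<in> triangles T \<and> ?v \<in> ?s" by (rule someI[of _ t]) (use node[OF t] t in simp)
    have "{s \<in> triangles T. ?v \<in> s \<and> n s = n t} = {s \<in> triangles T. ?v \<in> s}"
    proof (rule star_connected_across[OF v(1)])
      show "{s \<in> triangles T. ?v \<in> s \<and> n s = n t} \<noteq> {}" using t node(2)[OF t] by blast
      fix s \<kappa> assume s: "s \<in> {s \<in> triangles T. ?v \<in> s \<and> n s = n t}" and "\<kappa> \<noteq> color_of T ?v"
      then have \<kappa>: "\<kappa> \<noteq> Violet" using v(2) by simp
      have "?v \<in> across \<kappa> s" using across_in_star[of s ?v \<kappa>] s v \<kappa> by simp
      then show "across \<kappa> s \<in> {s \<in> triangles T. ?v \<in> s \<and> n s = n t}"
        using s across(1)[of s \<kappa>] n_const[OF _ \<kappa>, of s] by simp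
    qed blast
    then have "?s \<in> {s \<in> triangles T. ?v \<in> s \<and> n s = n t}" using s by simp
    then show ?thesis unfolding z_def by simp
  qed
  have "c w = z (node Violet (across Violet w)) - z (node Violet w)" if "w \<in> white T" for w
    using n_across[OF that, of Violet] z[OF white_triangle[OF that]] z[OF across(1)[OF white_triangle[OF that]]]
    by (simp add: J_def)
  then show ?thesis by blast
qed

text \<open>Around \<open>p\<close> the black triangles across the violet edges are the same as those across the edges of
  the other color \<open>\<kappa>\<close>, and crossing an edge of a color other than violet keeps the violet node. So
  the sums of \<open>z\<close> over the tails and over the heads agree.\<close>

lemma coboundary_balanced:
  fixes z :: "point \<Rightarrow> int"
  assumes p: "p \<in> points T" "color_of T p \<noteq> Violet"
  shows "(\<Sum>w\<in>white_at p. z (node Violet (across Violet w)) - z (node Violet w)) = 0"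
proof -
  obtain \<kappa> where \<kappa>: "\<kappa> \<noteq> Violet" "\<kappa> \<noteq> color_of T p" using color_neq_cases[OF p(2)] by blast
  have "(\<Sum>w\<in>white_at p. z (node Violet (across Violet w))) = (\<Sum>w\<in>white_at p. z (node Violet (across \<kappa> w)))"
    using sum_across[OF p(1) p(2)[symmetric] \<kappa>(2), of "\<lambda>t. z (node Violet t)"] .
  also have "\<dots> = (\<Sum>w\<in>white_at p. z (node Violet w))"
    using \<kappa>(1) by (intro sum.cong) (auto simp: white_at_def white_triangle node_across)
  finally show ?thesis by (simp add: sum_subtractf)
qed

end


section \<open>The Picard group of a finite digraph\<close>

lemma subgroup_free_Abelian_groupI:
  assumes "\<And>x. x \<in> N \<Longrightarrow> Poly_Mapping.keys x \<subseteq> S" "0 \<in> N"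
    "\<And>x y. x \<in> N \<Longrightarrow> y \<in> N \<Longrightarrow> x + y \<in> N" "\<And>x. x \<in> N \<Longrightarrow> - x \<in> N"
  shows "subgroup N (free_Abelian_group S)"
  by (rule group.subgroupI[OF group_free_Abelian_group]) (use assms in \<open>auto simp: subset_iff\<close>)

lemma keys_laplacian_apply:
  assumes "finite (verts D)"
  shows "Poly_Mapping.keys (laplacian_apply D z) \<subseteq> verts D"
proof -
  have "laplacian_apply D z \<in> carrier (free_Abelian_group (verts D))"
    unfolding laplacian_apply_def by (rule sum_closed_free_Abelian_group) auto
  then show ?thesis by simp
qed

lemma lookup_laplacian_apply:
  assumes "finite (verts D)" "u \<in> verts D"
  shows "Poly_Mapping.lookup (laplacian_apply D z) u = (\<Sum>v\<in>verts D. laplacian D u v * Poly_Mapping.lookup z v)"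
  using assms by (simp add: laplacian_apply_def lookup_sum if_distrib[of "\<lambda>x. _ * x"] sum.delta cong: if_cong)

lemma laplacian_apply_add: "laplacian_apply D (y + z) = laplacian_apply D y + laplacian_apply D z"
  by (simp add: laplacian_apply_def lookup_add distrib_left sum.distrib frag_cmul_distrib)

lemma laplacian_apply_uminus: "laplacian_apply D (- z) = - laplacian_apply D z"
  by (simp add: laplacian_apply_def sum_negf flip: minus_frag_cmul)

lemma laplacian_altdef:
  "laplacian D u v = int (arc_count D v u) - (if u = v then int (out_degree D v) else 0)"
  by (simp add: laplacian_def)

lemma deg_add: "deg D (x + y) = deg D x + deg D y"
  by (simp add: deg_def lookup_add sum.distrib)

lemma deg_diff: "deg D (x - y) = deg D x - deg D y"
  by (simp add: deg_def lookup_minus sum_subtractf)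

lemma deg_frag_of:
  assumes "finite (verts D)" "v \<in> verts D"
  shows "deg D (frag_cmul k (frag_of v)) = k"
  using assms by (simp add: deg_def if_distrib[of "\<lambda>x. _ * x"] cong: if_cong)

text \<open>The columns of the Laplacian sum to zero: each arc leaving \<open>v\<close> is counted once at its head.\<close>

lemma (in fin_digraph) deg_laplacian: "deg G (laplacian_apply G z) = 0"
proof -
  have col: "(\<Sum>u\<in>verts G. laplacian G u v) = 0" if v: "v \<in> verts G" for v
  proof -
    have "out_degree G v = card (\<Union>u\<in>verts G. {a \<in> arcs G. tail G a = v \<and> head G a = u})"
      unfolding out_degree_def out_arcs_def by (rule arg_cong[of _ _ card]) auto
    also have "\<dots> = (\<Sum>u\<in>verts G. arc_count G v u)"
      unfolding arc_count_def by (rule card_UN_disjoint) auto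
    finally show ?thesis
      using v by (simp add: laplacian_altdef sum_subtractf of_nat_sum)
  qed
  have "deg G (laplacian_apply G z)
      = (\<Sum>u\<in>verts G. \<Sum>v\<in>verts G. laplacian G u v * Poly_Mapping.lookup z v)"
    unfolding deg_def by (intro sum.cong refl lookup_laplacian_apply) auto
  also have "\<dots> = (\<Sum>v\<in>verts G. (\<Sum>u\<in>verts G. laplacian G u v) * Poly_Mapping.lookup z v)"
    by (subst sum.swap) (simp add: sum_distrib_right)
  also have "\<dots> = 0" using col by simp
  finally show ?thesis .
qed

lemma (in fin_digraph) subgroup_laplacian_image:
  "subgroup (laplacian_apply G ` carrier (Div G)) (Div G)"
  unfolding Div_def
proof (rule subgroup_free_Abelian_groupI)
  let ?N = "laplacian_apply G ` carrier (free_Abelian_group (verts G))"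
  show "Poly_Mapping.keys x \<subseteq> verts G" if "x \<in> ?N" for x
    using that keys_laplacian_apply[OF finite_verts] by auto
  have "laplacian_apply G 0 = 0" by (simp add: laplacian_apply_def)
  then show "0 \<in> ?N" by (metis carrier_free_Abelian_group_iff empty_subsetI image_eqI keys_zero)
  show "x + y \<in> ?N" if "x \<in> ?N" "y \<in> ?N" for x y
  proof -
    obtain a b where "x = laplacian_apply G a" "y = laplacian_apply G b"
      and ab: "Poly_Mapping.keys a \<subseteq> verts G" "Poly_Mapping.keys b \<subseteq> verts G" using \<open>x \<in> ?N\<close> \<open>y \<in> ?N\<close> by auto
    moreover have "Poly_Mapping.keys (a + b) \<subseteq> verts G" using ab keys_add[of a b] by blast
    ultimately show ?thesis by (auto simp flip: laplacian_apply_add)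
  qed
  show "- x \<in> ?N" if "x \<in> ?N" for x
    using that by (auto simp flip: laplacian_apply_uminus)
qed

text \<open>Fix a vertex \<open>v\<close>. The map \<open>x \<mapsto> ([x - deg x v], deg x)\<close> is onto, and its kernel is the image
  of the Laplacian since that consists of divisors of degree zero.\<close>

lemma (in fin_digraph) Pic_iso_Pic0_times_integers:
  assumes "verts G \<noteq> {}"
  shows "Pic G \<cong> Pic0 G \<times>\<times> integer_group"
proof -
  obtain v where v: "v \<in> verts G" using assms by blast
  let ?N = "laplacian_apply G ` carrier (Div G)"
  let ?\<pi> = "\<lambda>x. r_coset (Div G) ?N x"
  interpret Div: comm_group "Div G" unfolding Div_def by (rule abelian_free_Abelian_group)
  have N: "subgroup ?N (Div G)" by (rule subgroup_laplacian_image)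
  interpret N: normal ?N "Div G" by (rule Div.subgroup_imp_normal[OF N])
  interpret Pic: group "Pic G" unfolding Pic_def by (rule N.factorgroup_is_group)
  interpret \<pi>: group_hom "Div G" "Pic G" ?\<pi>
    by unfold_locales (use N.r_coset_hom_Mod in \<open>simp add: Pic_def\<close>)
  have DivD: "x \<in> carrier (Div G) \<longleftrightarrow> Poly_Mapping.keys x \<subseteq> verts G" for x by (simp add: Div_def)
  have plus: "x \<otimes>\<^bsub>Div G\<^esub> y = x + y" for x y by (simp add: Div_def)
  have deg_N: "deg G n = 0" if "n \<in> ?N" for n using that deg_laplacian by auto
  interpret deg: group_hom "Div G" integer_group "deg G"
    by (intro group_hom.intro group_hom_axioms.intro homI) (simp_all add: plus deg_add Div.group_axioms)
  let ?Z = "kernel (Div G) integer_group (deg G)"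
  have Z: "x \<in> ?Z \<longleftrightarrow> x \<in> carrier (Div G) \<and> deg G x = 0" for x by (simp add: kernel_def)
  have coset: "y \<in> ?\<pi> x \<Longrightarrow> deg G y = deg G x" for x y
    using deg_N by (auto simp: r_coset_def plus deg_add)
  have carrier_Pic0: "carrier (Pic0 G) = ?\<pi> ` ?Z"
  proof -
    have all_deg_0: "(\<forall>y\<in>?\<pi> x. deg G y = 0) \<longleftrightarrow> deg G x = 0" if "x \<in> carrier (Div G)" for x
      using coset Div.rcos_self[OF that N] by metis
    have "carrier (Pic G) = ?\<pi> ` carrier (Div G)"
      by (auto simp: Pic_def FactGroup_def RCOSETS_def)
    then have "carrier (Pic0 G) = {X \<in> ?\<pi> ` carrier (Div G). \<forall>y\<in>X. deg G y = 0}"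
      by (simp add: Pic0_def)
    also have "\<dots> = ?\<pi> ` {x \<in> carrier (Div G). \<forall>y\<in>?\<pi> x. deg G y = 0}" by blast
    also have "{x \<in> carrier (Div G). \<forall>y\<in>?\<pi> x. deg G y = 0} = ?Z"
    proof (rule Set.set_eqI)
      fix x show "x \<in> {x \<in> carrier (Div G). \<forall>y\<in>?\<pi> x. deg G y = 0} \<longleftrightarrow> x \<in> ?Z"
        using all_deg_0[of x] Z[of x] by blast
    qed
    finally show ?thesis .
  qed
  have "subgroup (?\<pi> ` ?Z) (Pic G)"
    by (rule \<pi>.subgroup_img_is_subgroup[OF deg.subgroup_kernel])
  then have Pic0: "subgroup (carrier (Pic0 G)) (Pic G)" unfolding carrier_Pic0 .
  have Pic0_eq: "Pic0 G = (Pic G)\<lparr>carrier := carrier (Pic0 G)\<rparr>" by (simp add: Pic0_def)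
  have grp: "group (Pic0 G)" by (subst Pic0_eq) (rule Pic.subgroup_imp_group[OF Pic0])
  have mult: "X \<otimes>\<^bsub>Pic0 G\<^esub> Y = X \<otimes>\<^bsub>Pic G\<^esub> Y" for X Y by (simp add: Pic0_def)
  have one: "\<one>\<^bsub>Pic0 G\<^esub> = ?N" by (simp add: Pic0_def Pic_def)
  define p where "p x = x - frag_cmul (deg G x) (frag_of v)" for x
  have p_Z: "p x \<in> ?Z" if "x \<in> carrier (Div G)" for x
  proof -
    have "Poly_Mapping.keys (p x) \<subseteq> verts G"
      using that v keys_diff[of x "frag_cmul (deg G x) (frag_of v)"] by (auto simp: p_def DivD split: if_splits)
    moreover have "deg G (p x) = 0"
      using v by (simp add: p_def deg_diff deg_frag_of)
    ultimately show ?thesis by (simp add: Z DivD)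
  qed
  have p_add: "p (x + y) = p x + p y" for x y by (simp add: p_def deg_add frag_cmul_distrib)
  define \<Phi> where "\<Phi> x = (?\<pi> (p x), deg G x)" for x
  interpret \<Phi>: group_hom "Div G" "Pic0 G \<times>\<times> integer_group" \<Phi>
  proof (intro group_hom.intro group_hom_axioms.intro homI)
    show "group (Pic0 G \<times>\<times> integer_group)" by (rule DirProd_group[OF grp group_integer_group])
    fix x y assume x: "x \<in> carrier (Div G)"
    show "\<Phi> x \<in> carrier (Pic0 G \<times>\<times> integer_group)"
      unfolding \<Phi>_def using p_Z[OF x] by (simp add: carrier_Pic0)
    assume y: "y \<in> carrier (Div G)"
    have "?\<pi> (p x + p y) = ?\<pi> (p x) \<otimes>\<^bsub>Pic G\<^esub> ?\<pi> (p y)"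
      using \<pi>.hom_mult[of "p x" "p y"] p_Z[OF x] p_Z[OF y] by (simp add: plus Z)
    then show "\<Phi> (x \<otimes>\<^bsub>Div G\<^esub> y) = \<Phi> x \<otimes>\<^bsub>Pic0 G \<times>\<times> integer_group\<^esub> \<Phi> y"
      unfolding \<Phi>_def by (simp add: plus p_add deg_add mult)
  qed (rule Div.group_axioms)
  have onto: "\<Phi> ` carrier (Div G) = carrier (Pic0 G \<times>\<times> integer_group)"
  proof
    show "carrier (Pic0 G \<times>\<times> integer_group) \<subseteq> \<Phi> ` carrier (Div G)"
    proof
      fix Xk assume "Xk \<in> carrier (Pic0 G \<times>\<times> integer_group)"
      then obtain y k where y: "y \<in> ?Z" "Xk = (?\<pi> y, k)" by (auto simp: carrier_Pic0)
      let ?x = "y + frag_cmul k (frag_of v)"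
      have d: "deg G ?x = k" using y(1) v by (simp add: deg_add deg_frag_of Z)
      then have "\<Phi> ?x = Xk" unfolding \<Phi>_def p_def y(2) by simp
      moreover have "?x \<in> carrier (Div G)"
        using y(1) v keys_add[of y "frag_cmul k (frag_of v)"] by (auto simp: Z DivD split: if_splits)
      ultimately show "Xk \<in> \<Phi> ` carrier (Div G)" by blast
    qed
  qed (use \<Phi>.hom_closed in blast)
  have "kernel (Div G) (Pic0 G \<times>\<times> integer_group) \<Phi> = ?N"
  proof -
    have "\<Phi> x = (?N, 0) \<longleftrightarrow> x \<in> ?N" if x: "x \<in> carrier (Div G)" for x
    proof -
      have "\<Phi> x = (?N, 0) \<longleftrightarrow> ?\<pi> x = ?N \<and> deg G x = 0" by (auto simp: \<Phi>_def p_def)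
      also have "\<dots> \<longleftrightarrow> x \<in> ?N"
        using deg_N[of x] Div.coset_join1[OF _ x N] Div.coset_join2[OF x N] by blast
      finally show ?thesis .
    qed
    moreover have "?N \<subseteq> carrier (Div G)" by (rule subgroup.subset[OF N])
    ultimately show ?thesis by (auto simp: kernel_def one)
  qed
  then show ?thesis using \<Phi>.FactGroup_iso[OF onto] unfolding Pic_def by simp
qed


section \<open>The violet part of the trinity sandpile group\<close>

context trinity
begin

lemma lookup_char_vec:
  "Poly_Mapping.lookup (char_vec T t) p = (if p \<in> points T \<inter> t then 1 else 0)"
  using finite_points by (simp add: char_vec_def lookup_sum)

lemma lookup_white_combination:
  "Poly_Mapping.lookup (\<Sum>t\<in>white T. frag_cmul (c t) (char_vec T t)) p
    = (if p \<in> points T then sum c (white_at p) else 0)"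
proof -
  have "(\<Sum>t\<in>white T. c t * (if p \<in> t then 1 else 0)) = sum c (white_at p)"
    unfolding white_at_def using finite_white by (simp add: sum.If_cases Int_def if_distrib cong: if_cong)
  then show ?thesis by (simp add: lookup_sum lookup_char_vec)
qed

text \<open>Every edge is a side of exactly one white triangle, so the white triangles parametrize the arcs
  and all computations in the digraph become sums over white triangles.\<close>

lemma arcs_violet_digraph: "bij_betw (side Violet) (white T) (arcs (violet_digraph T))"
proof (rule bij_betw_imageI)
  show "inj_on (side Violet) (white T)"
  proof (rule inj_onI, rule ccontr)
    fix w w' assume w: "w \<in> white T" "w' \<in> white T" "side Violet w = side Violet w'" "w \<noteq> w'"
    then have "w' = across Violet w"
      using across_eqI[of w w' Violet] side(1)[of w' Violet] white_triangle by simp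
    then show False using w(1,2) across_white_iff white_triangle by blast
  qed
  have "side Violet t \<in> edges_of_color T Violet" if t: "t \<in> triangles T" for t
  proof -
    have "color_of T p \<noteq> Violet" if "p \<in> points T \<inter> side Violet t" for p
    proof
      assume "color_of T p = Violet"
      moreover have "p \<in> points T \<inter> t - {node Violet t}" using that unfolding points_on_side[OF t] .
      ultimately show False using node_eqI[OF t, of p] by simp
    qed
    then show ?thesis
      unfolding edges_of_color_def using side(1)[OF t] sides_edges(1) by blast
  qed
  moreover have "e \<in> side Violet ` white T" if "e \<in> edges_of_color T Violet" for e
  proof -
    have e: "e \<in> edges T" "\<And>p. p \<in> points T \<inter> e \<Longrightarrow> color_of T p \<noteq> Violet"
      using that by (auto simp: edges_of_color_def)
    obtain t where t: "t \<in> triangles T" "e \<in> sides T t" using edge_is_side[OF e(1)] by blast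
    have "node Violet t \<notin> e" using e(2) node[OF t(1)] by blast
    then have "e = side Violet t" by (rule side_eqI[OF t])
    then show ?thesis
      using across_white_iff[OF t(1), of Violet] side_across[OF t(1), of Violet] by (cases "t \<in> white T") (auto intro: rev_image_eqI)
  qed
  ultimately show "side Violet ` white T = arcs (violet_digraph T)"
    unfolding violet_digraph_def using white_triangle by auto
qed

lemma violet_node: "t \<in> triangles T \<Longrightarrow> v \<in> color_class T Violet \<and> v \<in> t \<longleftrightarrow> v = node Violet t"
  using node[of t Violet] node_eqI[of t v] by (auto simp: color_class_def)

lemma tail_head_violet_digraph:
  assumes w: "w \<in> white T"
  shows "tail (violet_digraph T) (side Violet w) = node Violet (across Violet w)"
    and "head (violet_digraph T) (side Violet w) = node Violet w"
proof -
  note t = white_triangle[OF w]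
  have b: "across Violet w \<notin> white T" using across_white_iff[OF t] w by simp
  have only: "s = w \<or> s = across Violet w" if "s \<in> triangles T" "side Violet w \<in> sides T s" for s
    using across_eqI[OF t that(1) _ that(2)] by blast
  have "(v \<in> color_class T Violet \<and> (\<exists>s\<in>black T. side Violet w \<in> sides T s \<and> v \<in> s))
      \<longleftrightarrow> v = node Violet (across Violet w)" for v
    using only violet_node[OF across(1)[OF t], of v Violet] across[OF t, of Violet] w b
    unfolding black_def by blast
  then show "tail (violet_digraph T) (side Violet w) = node Violet (across Violet w)"
    by (simp add: violet_digraph_def)
  have "(v \<in> color_class T Violet \<and> (\<exists>s\<in>white T. side Violet w \<in> sides T s \<and> v \<in> s))
      \<longleftrightarrow> v = node Violet w" for v
    using only violet_node[OF t, of v] side(1)[OF t, of Violet] w b white_triangle by blast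
  then show "head (violet_digraph T) (side Violet w) = node Violet w"
    by (simp add: violet_digraph_def)
qed

lemma violet_class: "v \<in> color_class T Violet \<longleftrightarrow> v \<in> points T \<and> color_of T v = Violet"
  by (auto simp: color_class_def)

lemma fin_digraph_violet: "fin_digraph (violet_digraph T)"
proof
  show "finite (verts (violet_digraph T))" "finite (arcs (violet_digraph T))"
    using finite_points finite_edges by (simp_all add: violet_digraph_def color_class_def edges_of_color_def)
  fix e assume "e \<in> arcs (violet_digraph T)"
  then obtain w where w: "w \<in> white T" "e = side Violet w"
    using arcs_violet_digraph by (auto simp: bij_betw_def)
  have "node Violet t \<in> verts (violet_digraph T)" if "t \<in> triangles T" for t
    using node[OF that] by (simp add: violet_digraph_def violet_class)
  then show "tail (violet_digraph T) e \<in> verts (violet_digraph T)"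
    "head (violet_digraph T) e \<in> verts (violet_digraph T)"
    using tail_head_violet_digraph[OF w(1)] w across white_triangle by simp_all
qed

lemma verts_violet_digraph: "verts (violet_digraph T) = color_class T Violet"
  by (simp add: violet_digraph_def)

lemma card_violet_arcs:
  "card {a \<in> arcs (violet_digraph T). P (tail (violet_digraph T) a) (head (violet_digraph T) a)}
    = card {w \<in> white T. P (node Violet (across Violet w)) (node Violet w)}"
proof -
  have "{a \<in> arcs (violet_digraph T). P (tail (violet_digraph T) a) (head (violet_digraph T) a)}
      = side Violet ` {w \<in> white T. P (node Violet (across Violet w)) (node Violet w)}"
    unfolding bij_betw_imp_surj_on[OF arcs_violet_digraph, symmetric]
    by (auto simp: tail_head_violet_digraph)
  moreover have "inj_on (side Violet) {w \<in> white T. P (node Violet (across Violet w)) (node Violet w)}"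
    using bij_betw_imp_inj_on[OF arcs_violet_digraph] by (rule inj_on_subset) auto
  ultimately show ?thesis by (simp add: card_image)
qed

text \<open>The digraph is Eulerian: the arcs that leave \<open>v\<close> correspond to the black triangles at \<open>v\<close>, those that
  enter \<open>v\<close> to the white ones, and crossing the red edges at \<open>v\<close> matches the two.\<close>

lemma out_degree_violet:
  assumes v: "v \<in> color_class T Violet"
  shows "out_degree (violet_digraph T) v = card (white_at v)"
proof -
  have vp: "v \<in> points T" "color_of T v = Violet" using v by (simp_all add: violet_class)
  have at: "t \<in> triangles T \<Longrightarrow> node Violet t = v \<longleftrightarrow> v \<in> t" for t
    using violet_node[of t v] v by auto
  have "out_degree (violet_digraph T) v = card {w \<in> white T. node Violet (across Violet w) = v}"
    using card_violet_arcs[of "\<lambda>a b. a = v"] by (simp add: out_degree_def out_arcs_def)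
  also have "\<dots> = card {b \<in> triangles T - white T. v \<in> b}"
    by (rule bij_betw_same_card[of "across Violet"], rule bij_betw_byWitness[of _ "across Violet"])
       (auto simp: white_triangle across across_across across_white_iff at node(2))
  also have "\<dots> = card (white_at v)"
    using bij_betw_same_card[OF bij_betw_across[OF vp(1), of Red]] vp(2) by simp
  finally show ?thesis .
qed

text \<open>Since the outdegree equals the indegree, the Laplacian at \<open>u\<close> is the sum of the differences between
  tail and head over the arcs entering \<open>u\<close>.\<close>

lemma lookup_laplacian_violet:
  assumes u: "u \<in> color_class T Violet"
  shows "Poly_Mapping.lookup (laplacian_apply (violet_digraph T) z) u
    = (\<Sum>w\<in>white_at u. Poly_Mapping.lookup z (node Violet (across Violet w)) - Poly_Mapping.lookup z (node Violet w))"
proof -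
  let ?D = "violet_digraph T" and ?V = "color_class T Violet" and ?z = "Poly_Mapping.lookup z"
  have finV: "finite ?V" using finite_points by (simp add: color_class_def)
  have at: "t \<in> triangles T \<Longrightarrow> node Violet t = u \<longleftrightarrow> u \<in> t" for t
    using violet_node[of t u] u by auto
  have tail_V: "node Violet (across Violet w) \<in> ?V" if "w \<in> white_at u" for w
    using that node[OF across(1)[OF white_triangle]] by (auto simp: white_at_def violet_class)
  have count: "int (arc_count ?D v u) = (\<Sum>w\<in>white_at u. if node Violet (across Violet w) = v then 1 else 0)" for v
  proof -
    have "arc_count ?D v u = card {w \<in> white_at u. node Violet (across Violet w) = v}"
      unfolding arc_count_def using card_violet_arcs[of "\<lambda>a b. a = v \<and> b = u"]
      by (simp add: white_at_def at white_triangle conj_ac cong: conj_cong)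
    then show ?thesis using finite_white_at by (simp add: sum.If_cases Int_def)
  qed
  have "Poly_Mapping.lookup (laplacian_apply ?D z) u = (\<Sum>v\<in>?V. laplacian ?D u v * ?z v)"
    using lookup_laplacian_apply[of ?D u z] finV u by (simp add: verts_violet_digraph)
  also have "\<dots> = (\<Sum>v\<in>?V. int (arc_count ?D v u) * ?z v) - int (out_degree ?D u) * ?z u"
    using finV u by (simp add: laplacian_altdef left_diff_distrib sum_subtractf if_distrib[of "\<lambda>x. x * _"] cong: if_cong)
  also have "(\<Sum>v\<in>?V. int (arc_count ?D v u) * ?z v) = (\<Sum>w\<in>white_at u. ?z (node Violet (across Violet w)))"
  proof -
    have "(\<Sum>v\<in>?V. int (arc_count ?D v u) * ?z v)
        = (\<Sum>w\<in>white_at u. \<Sum>v\<in>?V. if node Violet (across Violet w) = v then ?z v else 0)"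
      unfolding count sum_distrib_right
      by (subst sum.swap) (intro sum.cong refl, simp)
    also have "\<dots> = (\<Sum>w\<in>white_at u. ?z (node Violet (across Violet w)))"
      using finV tail_V by (intro sum.cong refl) simp
    finally show ?thesis .
  qed
  also have "int (out_degree ?D u) * ?z u = (\<Sum>w\<in>white_at u. ?z (node Violet w))"
  proof -
    have "node Violet w = u" if "w \<in> white_at u" for w
      using that at white_triangle by (simp add: white_at_def)
    then show ?thesis unfolding out_degree_violet[OF u] by simp
  qed
  finally show ?thesis by (simp add: sum_subtractf)
qed

text \<open>The kernel of the map from divisors to classes. The component at \<open>p\<close> of a combination of white
  triangles is the sum of the coefficients around \<open>p\<close>, so the combinations supported on violet points
  are those with balanced coefficients; these are the coboundaries, whose combinations are the values
  of the Laplacian.\<close>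

lemma violet_part_of_white_span:
  "{x \<in> white_span T. Poly_Mapping.keys x \<subseteq> color_class T Violet}
    = laplacian_apply (violet_digraph T) ` carrier (Div (violet_digraph T))"
proof -
  let ?D = "violet_digraph T" and ?V = "color_class T Violet"
  have finV: "finite ?V" using finite_points by (simp add: color_class_def)
  have keysL: "Poly_Mapping.keys (laplacian_apply ?D z) \<subseteq> ?V" for z
    using keys_laplacian_apply[of ?D z] finV by (simp add: verts_violet_digraph)
  have eq: "(\<Sum>t\<in>white T. frag_cmul (c t) (char_vec T t)) = laplacian_apply ?D z"
    if c: "\<And>w. w \<in> white T \<Longrightarrow>
        c w = Poly_Mapping.lookup z (node Violet (across Violet w)) - Poly_Mapping.lookup z (node Violet w)" for c z
  proof (rule poly_mapping_eqI)
    fix p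
    let ?S = "\<Sum>w\<in>white_at p. Poly_Mapping.lookup z (node Violet (across Violet w)) - Poly_Mapping.lookup z (node Violet w)"
    have S: "sum c (white_at p) = ?S" using c by (intro sum.cong) (auto simp: white_at_def)
    have zero: "Poly_Mapping.lookup (laplacian_apply ?D z) p = 0" if "p \<notin> ?V"
      using that keysL[of z] by (auto simp flip: not_in_keys_iff_lookup_eq_zero)
    show "Poly_Mapping.lookup (\<Sum>t\<in>white T. frag_cmul (c t) (char_vec T t)) p
        = Poly_Mapping.lookup (laplacian_apply ?D z) p"
    proof (cases "p \<in> ?V")
      case True
      then show ?thesis
        using lookup_laplacian_violet[OF True, of z] S by (simp add: lookup_white_combination violet_class)
    next
      case False
      then show ?thesis
        using zero S coboundary_balanced[of p "Poly_Mapping.lookup z"]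
        by (auto simp: lookup_white_combination violet_class)
    qed
  qed
  show ?thesis
  proof (intro subset_antisym subsetI)
    fix x assume "x \<in> laplacian_apply ?D ` carrier (Div ?D)"
    then obtain z where x: "x = laplacian_apply ?D z" by blast
    let ?c = "\<lambda>w. Poly_Mapping.lookup z (node Violet (across Violet w)) - Poly_Mapping.lookup z (node Violet w)"
    have "x = (\<Sum>t\<in>white T. frag_cmul (?c t) (char_vec T t))" unfolding x by (rule eq[symmetric]) simp
    then have "x \<in> white_span T" unfolding white_span_def by (rule range_eqI[where x = ?c])
    then show "x \<in> {x \<in> white_span T. Poly_Mapping.keys x \<subseteq> ?V}" using keysL x by simp
  next
    fix x assume "x \<in> {x \<in> white_span T. Poly_Mapping.keys x \<subseteq> ?V}"
    then obtain c where x: "x = (\<Sum>t\<in>white T. frag_cmul (c t) (char_vec T t))"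
      and keys: "Poly_Mapping.keys x \<subseteq> ?V" unfolding white_span_def by blast
    have "sum c (white_at p) = 0" if "p \<in> points T" "color_of T p \<noteq> Violet" for p
    proof -
      have "p \<notin> Poly_Mapping.keys x" using keys that by (auto simp: violet_class)
      then show ?thesis
        using lookup_white_combination[of c p] that(1) by (simp add: x in_keys_iff)
    qed
    then obtain y where y: "\<And>w. w \<in> white T \<Longrightarrow> c w = y (node Violet (across Violet w)) - y (node Violet w)"
      using balanced_imp_coboundary[of c] by blast
    define z where "z = (\<Sum>v\<in>?V. frag_cmul (y v) (frag_of v))"
    have z: "Poly_Mapping.lookup z v = y v" if "v \<in> ?V" for v
      using that finV by (simp add: z_def lookup_sum if_distrib[of "\<lambda>x. _ * x"] cong: if_cong)
    have "z \<in> carrier (free_Abelian_group ?V)"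
      unfolding z_def by (rule sum_closed_free_Abelian_group) auto
    then have "z \<in> carrier (Div ?D)" by (simp add: Div_def verts_violet_digraph)
    moreover have "x = laplacian_apply ?D z"
    proof (unfold x, rule eq)
      fix w assume w: "w \<in> white T"
      have "node Violet t \<in> ?V" if "t \<in> triangles T" for t using node[OF that] by (simp add: violet_class)
      then show "c w = Poly_Mapping.lookup z (node Violet (across Violet w)) - Poly_Mapping.lookup z (node Violet w)"
        using y[OF w] z white_triangle[OF w] across(1)[OF white_triangle[OF w]] by simp
    qed
    ultimately show "x \<in> laplacian_apply ?D ` carrier (Div ?D)" by blast
  qed
qed

lemma points_by_color: "color_class T Violet \<union> color_class T Emerald \<union> color_class T Red = points T"
  unfolding color_class_def by (auto, metis color.exhaust)

lemma subgroup_white_span: "subgroup (white_span T) (trinity_chains T)"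
  unfolding trinity_chains_def points_by_color
proof (rule subgroup_free_Abelian_groupI)
  show "Poly_Mapping.keys x \<subseteq> points T" if span: "x \<in> white_span T" for x
  proof -
    obtain c where x: "x = (\<Sum>t\<in>white T. frag_cmul (c t) (char_vec T t))"
      using span unfolding white_span_def by blast
    show ?thesis unfolding x by (rule subsetI, rule ccontr) (simp add: in_keys_iff lookup_white_combination)
  qed
  show "0 \<in> white_span T"
    unfolding white_span_def by (rule range_eqI[of _ _ "\<lambda>_. 0"]) simp
  fix x assume "x \<in> white_span T"
  then obtain c where x: "x = (\<Sum>t\<in>white T. frag_cmul (c t) (char_vec T t))"
    unfolding white_span_def by blast
  show "- x \<in> white_span T"
    unfolding white_span_def x by (rule range_eqI[where x = "\<lambda>t. - c t"]) (simp flip: sum_negf)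
  fix y assume "y \<in> white_span T"
  then obtain d where y: "y = (\<Sum>t\<in>white T. frag_cmul (d t) (char_vec T t))"
    unfolding white_span_def by blast
  show "x + y \<in> white_span T"
    unfolding white_span_def x y
    by (rule range_eqI[where x = "\<lambda>t. c t + d t"]) (simp add: frag_cmul_distrib sum.distrib)
qed

lemma violet_classes_iso:
  "subgroup (violet_classes T) (trinity_group T)"
  "(trinity_group T)\<lparr>carrier := violet_classes T\<rparr> \<cong> Pic (violet_digraph T)"
proof -
  let ?D = "violet_digraph T" and ?A = "trinity_chains T" and ?H = "trinity_group T"
  let ?V = "color_class T Violet" and ?N = "white_span T"
  let ?\<pi> = "\<lambda>x. r_coset ?A ?N x"
  interpret A: comm_group ?A unfolding trinity_chains_def by (rule abelian_free_Abelian_group)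
  interpret N: normal ?N ?A by (rule A.subgroup_imp_normal[OF subgroup_white_span])
  interpret H: group ?H unfolding trinity_group_def by (rule N.factorgroup_is_group)
  interpret \<pi>: group_hom ?A ?H ?\<pi>
    by unfold_locales (use N.r_coset_hom_Mod in \<open>simp add: trinity_group_def\<close>)
  have Div: "Div ?D = free_Abelian_group ?V" by (simp add: Div_def verts_violet_digraph)
  have A: "x \<in> carrier ?A" if "x \<in> carrier (Div ?D)" for x
    using that by (auto simp: Div trinity_chains_def)
  interpret \<psi>: group_hom "Div ?D" ?H ?\<pi>
  proof (intro group_hom.intro group_hom_axioms.intro homI)
    show "group (Div ?D)" by (simp add: Div)
    show "?\<pi> x \<in> carrier ?H" if "x \<in> carrier (Div ?D)" for x using A[OF that] by simp
    show "?\<pi> (x \<otimes>\<^bsub>Div ?D\<^esub> y) = ?\<pi> x \<otimes>\<^bsub>?H\<^esub> ?\<pi> y"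
      if "x \<in> carrier (Div ?D)" "y \<in> carrier (Div ?D)" for x y
      using \<pi>.hom_mult[OF A[OF that(1)] A[OF that(2)]] by (simp add: Div trinity_chains_def)
  qed (rule H.group_axioms)
  have image: "?\<pi> ` carrier (Div ?D) = violet_classes T"
  proof (intro subset_antisym subsetI)
    fix X assume "X \<in> ?\<pi> ` carrier (Div ?D)"
    then obtain x where x: "x \<in> carrier (Div ?D)" "X = ?\<pi> x" by blast
    have "x \<in> X" using A.rcos_self[OF A[OF x(1)] subgroup_white_span] x(2) by simp
    then show "X \<in> violet_classes T"
      using x \<psi>.hom_closed[OF x(1)] unfolding violet_classes_def Div by blast
  next
    fix X assume "X \<in> violet_classes T"
    then obtain x where X: "X \<in> carrier ?H" "x \<in> X" "x \<in> carrier (Div ?D)"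
      unfolding violet_classes_def Div by blast
    obtain y where y: "y \<in> carrier ?A" "X = ?\<pi> y"
      using X(1) by (auto simp: trinity_group_def FactGroup_def RCOSETS_def)
    have "?\<pi> y = ?\<pi> x" using A.repr_independence[OF _ y(1) subgroup_white_span] X(2) y(2) by blast
    then show "X \<in> ?\<pi> ` carrier (Div ?D)" using X(3) y(2) by blast
  qed
  have "subgroup (?\<pi> ` carrier (Div ?D)) ?H" by (rule \<psi>.img_is_subgroup)
  then show sub: "subgroup (violet_classes T) ?H" unfolding image .
  let ?K = "?H\<lparr>carrier := violet_classes T\<rparr>"
  have grpK: "group ?K" by (rule H.subgroup_imp_group[OF sub])
  interpret \<phi>: group_hom "Div ?D" ?K ?\<pi>
  proof (intro group_hom.intro group_hom_axioms.intro homI)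
    show "?\<pi> x \<in> carrier ?K" if "x \<in> carrier (Div ?D)" for x using that image by auto
  qed (use grpK \<psi>.hom_mult in \<open>simp_all add: Div\<close>)
  have "kernel (Div ?D) ?K ?\<pi> = {x \<in> carrier (Div ?D). ?\<pi> x = ?N}"
    by (simp add: kernel_def trinity_group_def)
  also have "\<dots> = {x \<in> ?N. Poly_Mapping.keys x \<subseteq> ?V}"
    using A.coset_join1[OF _ A subgroup_white_span] A.coset_join2[OF A subgroup_white_span]
    by (auto simp: Div)
  finally have "kernel (Div ?D) ?K ?\<pi> = laplacian_apply ?D ` carrier (Div ?D)"
    unfolding violet_part_of_white_span .
  then have "Pic ?D \<cong> ?K" using \<phi>.FactGroup_iso image unfolding Pic_def by simp
  then show "?K \<cong> Pic ?D"
    using group.iso_sym normal.factorgroup_is_group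
    by (metis Pic_def \<phi>.normal_kernel \<open>kernel (Div ?D) ?K ?\<pi> = laplacian_apply ?D ` carrier (Div ?D)\<close>)
qed

lemma violet_nonempty: "color_class T Violet \<noteq> {}"
proof -
  have "axis 1 1 \<in> S2" by (simp add: norm_axis_1)
  then obtain t where "t \<in> triangles T" using triangles_cover by blast
  then show ?thesis using node[of t Violet] by (auto simp: color_class_def)
qed

end

theorem theorem3p1:
  fixes T :: trinity_data
  assumes "trinity T"
  shows "subgroup (violet_classes T) (trinity_group T)
    \<and> (trinity_group T)\<lparr>carrier := violet_classes T\<rparr> \<cong> Pic (violet_digraph T)
    \<and> Pic (violet_digraph T) \<cong> Pic0 (violet_digraph T) \<times>\<times> integer_group"
proof -
  interpret trinity T by fact
  interpret fin_digraph "violet_digraph T" by (rule fin_digraph_violet)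
  show ?thesis
    using violet_classes_iso Pic_iso_Pic0_times_integers violet_nonempty
    by (simp add: verts_violet_digraph)
qed

end
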